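(* There is a $2^{2^{x^{\varepsilon}}}$ speedup of $\mathsf{Tarski}$ over $\mathsf{RCF}$. That is, there exist a constant $\varepsilon>0$ and a sequence of sentences $(\varphi_i)_{i<\omega}$ of the language $\mathcal{L}_{\mathsf{RCF}}$ such that the length of $\varphi_i$ is bounded by a polynomial in $i$, each $\varphi_i$ has a proof in $\mathsf{Tarski}$ of length bounded by a polynomial in $i$, but every proof of $\varphi_i$ in $\mathsf{RCF}$ has length at least $2^{2^{i^{\varepsilon}}}$.
   Context: $\mathcal{L}_{\mathsf{RCF}}$ is the first-order language with equality, constants $0,1$ and binary function symbols $+,\cdot$. $\mathsf{RCF}^-$ is the theory with: (1) the axioms of fields; (2) the axioms stating that $\le$ is a linear order compatible with the field operations, where $x\le y$ abbreviates $\exists z\; x+z^2=y$. $\mathsf{RCF}$ is $\mathsf{RCF}^-$ together with the axiom $\forall z\ge 0\,\exists x\; x^2-z=0$ and, for each odd natural number $n$, the axiom $\forall a_0,\dots,a_{n-1}\,\exists x\; x^n+a_{n-1}x^{n-1}+\dots+a_0=0$, where $x^i$ abbreviates $x\cdot x\cdots x$ ($i$ times). $\mathsf{Tarski}$ is $\mathsf{RCF}^-$ together with the least upper bound schema: for every $\mathcal{L}_{\mathsf{RCF}}$-formula $\phi(x)$ (possibly with other free variables), the axiom $$\big(\exists d\,\phi(d)\wedge \exists b\,\forall x(\phi(x)\rightarrow x\le b)\big)\rightarrow \exists c\,\big(\forall x(\phi(x)\rightarrow x\le c)\wedge\forall b(\forall x(\phi(x)\rightarrow x\le b)\rightarrow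 c\le b)\big).$$ Proofs are taken in any fixed standard proof system for first-order logic such as a Hilbert-style system, natural deduction, or sequent calculus with cut (these are polynomially equivalent). Length (size) of formulas and proofs is the number of characters. *)

theory Defs
  imports Complex_Main "HOL-Computational_Algebra.Polynomial"
begin

section \<open>The language of real closed fields\<close>

datatype trm = Var nat | Zer | Unity | Add trm trm | Mul trm trm

datatype fm =
    Eq trm trm
  | Bot
  | Imp fm fm
  | And fm fm
  | Or fm fm
  | All nat fm
  | Ex nat fm

abbreviation Neg :: "fm \<Rightarrow> fm" where
  "Neg \<phi> \<equiv> Imp \<phi> Bot"

abbreviation Alls :: "nat list \<Rightarrow> fm \<Rightarrow> fm" where
  "Alls xs \<phi> \<equiv> foldr All xs \<phi>"

primrec tvars :: "trm \<Rightarrow> nat set" where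
  "tvars (Var n) = {n}"
| "tvars Zer = {}"
| "tvars Unity = {}"
| "tvars (Add s t) = tvars s \<union> tvars t"
| "tvars (Mul s t) = tvars s \<union> tvars t"

primrec fv :: "fm \<Rightarrow> nat set" where
  "fv (Eq s t) = tvars s \<union> tvars t"
| "fv Bot = {}"
| "fv (Imp \<phi> \<psi>) = fv \<phi> \<union> fv \<psi>"
| "fv (And \<phi> \<psi>) = fv \<phi> \<union> fv \<psi>"
| "fv (Or \<phi> \<psi>) = fv \<phi> \<union> fv \<psi>"
| "fv (All x \<phi>) = fv \<phi> - {x}"
| "fv (Ex x \<phi>) = fv \<phi> - {x}"

definition sentence :: "fm \<Rightarrow> bool" where
  "sentence \<phi> \<longleftrightarrow> fv \<phi> = {}"

definition closure :: "fm \<Rightarrow> fm" where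
  "closure \<phi> = Alls (sorted_list_of_set (fv \<phi>)) \<phi>"

text \<open>
  Substitution does not rename bound variables; the rules that use it demand that the
  substituted term is free for the variable.
\<close>

primrec tsubst :: "nat \<Rightarrow> trm \<Rightarrow> trm \<Rightarrow> trm" where
  "tsubst x t (Var n) = (if n = x then t else Var n)"
| "tsubst x t Zer = Zer"
| "tsubst x t Unity = Unity"
| "tsubst x t (Add r s) = Add (tsubst x t r) (tsubst x t s)"
| "tsubst x t (Mul r s) = Mul (tsubst x t r) (tsubst x t s)"

primrec subst :: "nat \<Rightarrow> trm \<Rightarrow> fm \<Rightarrow> fm" where
  "subst x t (Eq r s) = Eq (tsubst x t r) (tsubst x t s)"
| "subst x t Bot = Bot"
| "subst x t (Imp \<phi> \<psi>) = Imp (subst x t \<phi>) (subst x t \<psi>)"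
| "subst x t (And \<phi> \<psi>) = And (subst x t \<phi>) (subst x t \<psi>)"
| "subst x t (Or \<phi> \<psi>) = Or (subst x t \<phi>) (subst x t \<psi>)"
| "subst x t (All y \<phi>) = (if y = x then All y \<phi> else All y (subst x t \<phi>))"
| "subst x t (Ex y \<phi>) = (if y = x then Ex y \<phi> else Ex y (subst x t \<phi>))"

primrec free_for :: "trm \<Rightarrow> nat \<Rightarrow> fm \<Rightarrow> bool" where
  "free_for t x (Eq r s) = True"
| "free_for t x Bot = True"
| "free_for t x (Imp \<phi> \<psi>) = (free_for t x \<phi> \<and> free_for t x \<psi>)"
| "free_for t x (And \<phi> \<psi>) = (free_for t x \<phi> \<and> free_for t x \<psi>)"
| "free_for t x (Or \<phi> \<psi>) = (free_for t x \<phi> \<and> free_for t x \<psi>)"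
| "free_for t x (All y \<phi>) = (x \<notin> fv (All y \<phi>) \<or> y \<notin> tvars t \<and> free_for t x \<phi>)"
| "free_for t x (Ex y \<phi>) = (x \<notin> fv (Ex y \<phi>) \<or> y \<notin> tvars t \<and> free_for t x \<phi>)"

section \<open>Natural deduction\<close>

text \<open>
  Classical natural deduction in sequent notation: \<open>(\<Gamma>, \<phi>)\<close> states that \<open>\<phi>\<close> follows from the
  open assumptions \<open>\<Gamma>\<close>.  A proof is a sequence of sequents, each of which is inferred by one
  rule from earlier ones; the argument \<open>P\<close> below is the set of earlier sequents.
\<close>

type_synonym sequent = "fm list \<times> fm"

abbreviation fvs :: "fm list \<Rightarrow> nat set" where
  "fvs \<Gamma> \<equiv> (\<Union>\<phi>\<in>set \<Gamma>. fv \<phi>)"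

inductive infer :: "fm set \<Rightarrow> sequent set \<Rightarrow> sequent \<Rightarrow> bool" for T P where
  Axiom: "\<phi> \<in> T \<Longrightarrow> infer T P (\<Gamma>, \<phi>)"
| Assume: "\<phi> \<in> set \<Gamma> \<Longrightarrow> infer T P (\<Gamma>, \<phi>)"
| Weaken: "(\<Gamma>, \<phi>) \<in> P \<Longrightarrow> set \<Gamma> \<subseteq> set \<Delta> \<Longrightarrow> infer T P (\<Delta>, \<phi>)"
| ImpI: "(\<phi> # \<Gamma>, \<psi>) \<in> P \<Longrightarrow> infer T P (\<Gamma>, Imp \<phi> \<psi>)"
| ImpE: "(\<Gamma>, Imp \<phi> \<psi>) \<in> P \<Longrightarrow> (\<Gamma>, \<phi>) \<in> P \<Longrightarrow> infer T P (\<Gamma>, \<psi>)"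
| AndI: "(\<Gamma>, \<phi>) \<in> P \<Longrightarrow> (\<Gamma>, \<psi>) \<in> P \<Longrightarrow> infer T P (\<Gamma>, And \<phi> \<psi>)"
| AndE1: "(\<Gamma>, And \<phi> \<psi>) \<in> P \<Longrightarrow> infer T P (\<Gamma>, \<phi>)"
| AndE2: "(\<Gamma>, And \<phi> \<psi>) \<in> P \<Longrightarrow> infer T P (\<Gamma>, \<psi>)"
| OrI1: "(\<Gamma>, \<phi>) \<in> P \<Longrightarrow> infer T P (\<Gamma>, Or \<phi> \<psi>)"
| OrI2: "(\<Gamma>, \<psi>) \<in> P \<Longrightarrow> infer T P (\<Gamma>, Or \<phi> \<psi>)"
| OrE: "(\<Gamma>, Or \<phi> \<psi>) \<in> P \<Longrightarrow> (\<phi> # \<Gamma>, \<chi>) \<in> P \<Longrightarrow> (\<psi> # \<Gamma>, \<chi>) \<in> P \<Longrightarrow> infer T P (\<Gamma>, \<chi>)"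
| Classical: "(Neg \<phi> # \<Gamma>, Bot) \<in> P \<Longrightarrow> infer T P (\<Gamma>, \<phi>)"
| AllI: "(\<Gamma>, subst x (Var y) \<phi>) \<in> P \<Longrightarrow> free_for (Var y) x \<phi> \<Longrightarrow>
    y \<notin> fvs \<Gamma> \<union> fv (All x \<phi>) \<Longrightarrow> infer T P (\<Gamma>, All x \<phi>)"
| AllE: "(\<Gamma>, All x \<phi>) \<in> P \<Longrightarrow> free_for t x \<phi> \<Longrightarrow> infer T P (\<Gamma>, subst x t \<phi>)"
| ExI: "(\<Gamma>, subst x t \<phi>) \<in> P \<Longrightarrow> free_for t x \<phi> \<Longrightarrow> infer T P (\<Gamma>, Ex x \<phi>)"
| ExE: "(\<Gamma>, Ex x \<phi>) \<in> P \<Longrightarrow> (subst x (Var y) \<phi> # \<Gamma>, \<chi>) \<in> P \<Longrightarrow> free_for (Var y) x \<phi> \<Longrightarrow>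
    y \<notin> fvs \<Gamma> \<union> fv (Ex x \<phi>) \<union> fv \<chi> \<Longrightarrow> infer T P (\<Gamma>, \<chi>)"
| EqI: "infer T P (\<Gamma>, Eq t t)"
| EqE: "(\<Gamma>, Eq s t) \<in> P \<Longrightarrow> (\<Gamma>, subst x s \<phi>) \<in> P \<Longrightarrow> free_for s x \<phi> \<Longrightarrow> free_for t x \<phi> \<Longrightarrow>
    infer T P (\<Gamma>, subst x t \<phi>)"

definition is_proof :: "fm set \<Rightarrow> sequent list \<Rightarrow> fm \<Rightarrow> bool" where
  "is_proof T \<pi> \<phi> \<longleftrightarrow>
     \<pi> \<noteq> [] \<and> last \<pi> = ([], \<phi>) \<and> (\<forall>i<length \<pi>. infer T (set (take i \<pi>)) (\<pi> ! i))"

section \<open>Length as number of characters\<close>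

text \<open>
  Variables are written as the letter \<open>x\<close> followed by their index in binary, so that formulas
  and proofs are words over a fixed finite alphabet.
\<close>

fun bin_str :: "nat \<Rightarrow> string" where
  "bin_str n = (if n < 2 then (if n = 0 then ''0'' else ''1'')
     else bin_str (n div 2) @ bin_str (n mod 2))"

declare bin_str.simps [simp del]

primrec trm_str :: "trm \<Rightarrow> string" where
  "trm_str (Var n) = ''x'' @ bin_str n"
| "trm_str Zer = ''0''"
| "trm_str Unity = ''1''"
| "trm_str (Add s t) = ''('' @ trm_str s @ ''+'' @ trm_str t @ '')''"
| "trm_str (Mul s t) = ''('' @ trm_str s @ ''*'' @ trm_str t @ '')''"

primrec fm_str :: "fm \<Rightarrow> string" where
  "fm_str (Eq s t) = ''('' @ trm_str s @ ''='' @ trm_str t @ '')''"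
| "fm_str Bot = ''F''"
| "fm_str (Imp \<phi> \<psi>) = ''('' @ fm_str \<phi> @ ''>'' @ fm_str \<psi> @ '')''"
| "fm_str (And \<phi> \<psi>) = ''('' @ fm_str \<phi> @ ''&'' @ fm_str \<psi> @ '')''"
| "fm_str (Or \<phi> \<psi>) = ''('' @ fm_str \<phi> @ ''|'' @ fm_str \<psi> @ '')''"
| "fm_str (All x \<phi>) = ''A'' @ trm_str (Var x) @ fm_str \<phi>"
| "fm_str (Ex x \<phi>) = ''E'' @ trm_str (Var x) @ fm_str \<phi>"

definition sequent_str :: "sequent \<Rightarrow> string" where
  "sequent_str s = concat (map (\<lambda>\<psi>. fm_str \<psi> @ '','') (fst s)) @ '':'' @ fm_str (snd s)"

definition fm_length :: "fm \<Rightarrow> nat" where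
  "fm_length \<phi> = length (fm_str \<phi>)"

definition proof_length :: "sequent list \<Rightarrow> nat" where
  "proof_length \<pi> = length (concat (map (\<lambda>s. sequent_str s @ '';'') \<pi>))"

section \<open>The theories\<close>

text \<open>
  \<open>Le z s t\<close> is the formula abbreviated by \<open>s \<le> t\<close>; the bound variable \<open>z\<close> must not occur
  in \<open>s\<close> and \<open>t\<close>.
\<close>

definition Le :: "nat \<Rightarrow> trm \<Rightarrow> trm \<Rightarrow> fm" where
  "Le z s t = Ex z (Eq (Add s (Mul (Var z) (Var z))) t)"

definition field_axioms :: "fm set" where
  "field_axioms = (let x = Var 0; y = Var 1; z = Var 2 in
    {Alls [0, 1, 2] (Eq (Add (Add x y) z) (Add x (Add y z))),
     Alls [0, 1] (Eq (Add x y) (Add y x)),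
     Alls [0] (Eq (Add x Zer) x),
     Alls [0] (Ex 1 (Eq (Add x y) Zer)),
     Alls [0, 1, 2] (Eq (Mul (Mul x y) z) (Mul x (Mul y z))),
     Alls [0, 1] (Eq (Mul x y) (Mul y x)),
     Alls [0] (Eq (Mul x Unity) x),
     Alls [0] (Imp (Neg (Eq x Zer)) (Ex 1 (Eq (Mul x y) Unity))),
     Alls [0, 1, 2] (Eq (Mul x (Add y z)) (Add (Mul x y) (Mul x z))),
     Neg (Eq Zer Unity)})"

definition order_axioms :: "fm set" where
  "order_axioms = (let x = Var 0; y = Var 1; z = Var 2; le = Le 3 in
    {Alls [0] (le x x),
     Alls [0, 1] (Imp (And (le x y) (le y x)) (Eq x y)),
     Alls [0, 1, 2] (Imp (And (le x y) (le y z)) (le x z)),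
     Alls [0, 1] (Or (le x y) (le y x)),
     Alls [0, 1, 2] (Imp (le x y) (le (Add x z) (Add y z))),
     Alls [0, 1] (Imp (And (le Zer x) (le Zer y)) (le Zer (Mul x y)))})"

definition RCF_minus :: "fm set" where
  "RCF_minus = field_axioms \<union> order_axioms"

text \<open>The language has no subtraction: \<open>x\<^sup>2 - z = 0\<close> is written \<open>x \<cdot> x = z\<close>.\<close>

definition sqrt_axiom :: fm where
  "sqrt_axiom = All 0 (Imp (Le 2 Zer (Var 0)) (Ex 1 (Eq (Mul (Var 1) (Var 1)) (Var 0))))"

text \<open>\<open>tpow t n\<close> is the product with exactly \<open>n\<close> factors \<open>t\<close> (only used for \<open>n \<ge> 1\<close>).\<close>

primrec tpow :: "trm \<Rightarrow> nat \<Rightarrow> trm" where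
  "tpow t 0 = Unity"
| "tpow t (Suc n) = (if n = 0 then t else Mul (tpow t n) t)"

text \<open>
  \<open>low_poly t k\<close> is \<open>a\<^sub>k t\<^sup>k + \<dots> + a\<^sub>1 t + a\<^sub>0\<close>, the coefficient \<open>a\<^sub>j\<close> being the
  variable with index \<open>j\<close>.
\<close>

primrec low_poly :: "trm \<Rightarrow> nat \<Rightarrow> trm" where
  "low_poly t 0 = Var 0"
| "low_poly t (Suc k) = Add (Mul (Var (Suc k)) (tpow t (Suc k))) (low_poly t k)"

definition root_axiom :: "nat \<Rightarrow> fm" where
  "root_axiom n =
     Alls [0..<n] (Ex n (Eq (Add (tpow (Var n) n) (low_poly (Var n) (n - 1))) Zer))"

definition RCF :: "fm set" where
  "RCF = RCF_minus \<union> {sqrt_axiom} \<union> {root_axiom n | n. odd n}"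

text \<open>
  In \<open>lub x b c z \<phi>\<close> the formula \<open>\<phi>\<close> plays the role of \<open>\<phi>(x)\<close>; the premise \<open>\<exists>d \<phi>(d)\<close> is
  written with \<open>x\<close> itself as bound variable.  The remaining free variables of \<open>\<phi>\<close> are
  parameters, over which the axiom is universally closed.
\<close>

definition lub :: "nat \<Rightarrow> nat \<Rightarrow> nat \<Rightarrow> nat \<Rightarrow> fm \<Rightarrow> fm" where
  "lub x b c z \<phi> =
    (let upper = (\<lambda>v. All x (Imp \<phi> (Le z (Var x) (Var v)))) in
     Imp (And (Ex x \<phi>) (Ex b (upper b)))
         (Ex c (And (upper c) (All b (Imp (upper b) (Le z (Var c) (Var b)))))))"

definition Tarski :: "fm set" where
  "Tarski = RCF_minus \<union>
     {closure (lub x b c z \<phi>) | x b c z \<phi>.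
        distinct [x, b, c, z] \<and> b \<notin> fv \<phi> \<and> c \<notin> fv \<phi>}"

end

theory Submission
  imports Defs "HOL-Computational_Algebra.Primes"
    "HOL-Computational_Algebra.Fundamental_Theorem_Algebra"
begin

text \<open>
  The sentences are themselves least upper bound axioms, for the formula \<open>x\<^sup>n \<le> 2\<close> with parameter
  \<open>n\<close>, so their proofs in Tarski have one line.  The relation \<open>y = x\<^sup>n\<close> for natural numbers \<open>n\<close> up
  to \<open>2\<^bsup>2\<^bsup>k\<^esup>\<^esup>\<close> is definable by a formula of length linear in \<open>k\<close>.

  For the lower bound take a prime \<open>p\<close> just below that limit and a maximal subfield \<open>K\<close> of the
  reals that does not contain \<open>\<alpha> = 2\<^bsup>1/p\<^esup>\<close>.  Over any real field the degree of \<open>\<alpha>\<close> is \<open>1\<close> or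
  \<open>p\<close>.  Hence adjoining to \<open>K\<close> a real root of a polynomial of degree less than \<open>p\<close> cannot produce
  \<open>\<alpha>\<close>, and by maximality \<open>K\<close> contains all such roots.  So \<open>K\<close> satisfies the root axioms of degree
  less than \<open>p\<close>, whereas \<open>{x \<in> K. x\<^sup>p \<le> 2}\<close> has no supremum in \<open>K\<close>, and a proof in RCF must
  contain a root axiom of degree at least \<open>p\<close>.
\<close>

section \<open>A prime between double exponentials\<close>

text \<open>The reciprocals of these products form Leibniz's harmonic triangle, where 1/(m C(m+d,
  m)) - 1/((m+1) C(m+d+1, m+1)) = 1/(m C(m+d+1, m)). After multiplication by \<open>D\<close>,
  induction on \<open>d\<close> makes both terms on the left integers.\<close>

lemma mult_binomial_dvd_common_multiple:
  fixes D :: nat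
  assumes "\<And>j. 1 \<le> j \<Longrightarrow> j \<le> n \<Longrightarrow> j dvd D" and "1 \<le> m" and "m + d \<le> n"
  shows "m * ((m + d) choose m) dvd D"
  using assms(2,3)
proof (induction d arbitrary: m)
  case 0
  then show ?case using assms(1) by simp
next
  case (Suc d)
  define B where "B = (m + d) choose m"
  define C where "C = (m + Suc d) choose m"
  have C: "Suc d * C = Suc (m + d) * B"
    unfolding C_def B_def using binomial_absorb_comp[of "Suc (m + d)" m] by simp
  have 1: "m * B dvd D"
    unfolding B_def using Suc.IH[of m] Suc.prems by simp
  have "Suc m * ((Suc m + d) choose Suc m) dvd D"
    using Suc.IH[of "Suc m"] Suc.prems by simp
  also have "Suc m * ((Suc m + d) choose Suc m) = Suc (m + d) * B"
    unfolding B_def using Suc_times_binomial[of m "m + d"] by simp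
  finally have 2: "Suc (m + d) * B dvd D" .
  obtain x where x: "D = m * B * x" using 1 by blast
  obtain y where y: "D = Suc (m + d) * B * y" using 2 by blast
  \<comment> \<open>The recurrence times \<open>D\<close>, with denominators cleared, over the
    integers because natural subtraction truncates.\<close>
  have "int (Suc d) * (int (m * C) * (int x - int y))
      = int m * int (Suc d * C) * int x - int m * int (Suc d * C) * int y"
    by (simp only: of_nat_mult) (simp only: algebra_simps)
  also have "\<dots> = int (Suc (m + d)) * int (m * B * x) - int m * int (Suc (m + d) * B * y)"
    unfolding C by (simp only: of_nat_mult ac_simps)
  also have "\<dots> = int (Suc d) * int D"
    unfolding x[symmetric] y[symmetric] by (simp add: algebra_simps)
  finally have "int D = int (m * C) * (int x - int y)" by simp
  then have "int (m * C) dvd int D" by simp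
  then show ?case unfolding C_def by presburger
qed

text \<open>
  The common multiple \<open>D\<close> of the numbers up to \<open>2n\<close> below has at most \<open>N\<close> prime power factors,
  each at most \<open>2n\<close>.
\<close>

lemma no_prime_between_bound:
  fixes N n :: nat
  assumes "0 < n" and no: "\<And>p. prime p \<Longrightarrow> p \<le> 2 * n \<Longrightarrow> p \<le> N"
  shows "4 ^ n \<le> 2 * (2 * n) ^ N"
proof -
  define e where "e = (\<lambda>q::nat. Max {k. q ^ k \<le> 2 * n})"
  define Q where "Q = {q. prime q \<and> q \<le> N}"
  define D where "D = (\<Prod>q\<in>Q. q ^ e q)"
  have finQ: "finite Q" unfolding Q_def by simp
  have fin: "finite {k. q ^ k \<le> 2 * n}" if "prime q" for q
  proof (rule finite_subset)
    show "{k. q ^ k \<le> 2 * n} \<subseteq> {..2 * n}"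
    proof
      fix k assume "k \<in> {k. q ^ k \<le> 2 * n}"
      moreover have "k < q ^ k"
        using less_exp[of k] power_mono[of 2 q k] prime_ge_2_nat[OF that] by linarith
      ultimately show "k \<in> {..2 * n}" by simp
    qed
  qed simp
  have e: "q ^ e q \<le> 2 * n" if "prime q" for q
  proof -
    have "0 \<in> {k. q ^ k \<le> 2 * n}" using assms(1) by simp
    then have "e q \<in> {k. q ^ k \<le> 2 * n}"
      unfolding e_def using Max_in[OF fin[OF that]] by blast
    then show ?thesis by simp
  qed
  have Dpos: "D > 0" unfolding D_def Q_def by (auto intro!: prod_pos simp: prime_gt_0_nat)
  have cm: "j dvd D" if j: "1 \<le> j" "j \<le> 2 * n" for j
  proof (rule multiplicity_le_imp_dvd)
    show "j \<noteq> 0" using j by simp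
    fix q :: nat assume q: "prime q"
    show "multiplicity q j \<le> multiplicity q D"
    proof (cases "q dvd j")
      case False
      then show ?thesis by (simp add: not_dvd_imp_multiplicity_0)
    next
      case True
      then have "q \<le> 2 * n" using j dvd_imp_le[of q j] by simp
      then have "q \<in> Q" unfolding Q_def using no q by blast
      then have "q ^ e q dvd D" unfolding D_def by (rule dvd_prodI[OF finQ])
      moreover have "multiplicity q j \<le> e q"
      proof -
        have "q ^ multiplicity q j dvd j" by (rule multiplicity_dvd)
        then have "q ^ multiplicity q j \<le> j" using j by (simp add: dvd_imp_le)
        then have "q ^ multiplicity q j \<le> 2 * n" using j by linarith
        then show ?thesis unfolding e_def using fin[OF q] by simp
      qed
      ultimately show ?thesis
        using multiplicity_geI[of D q "e q"] Dpos q prime_gt_1_nat[OF q] by auto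
    qed
  qed
  \<comment> \<open>The central binomial coefficient is at least \<open>4^n / (2 * n)\<close>, so
    this bounds \<open>D\<close> from below.\<close>
  have "n * ((n + n) choose n) dvd D"
    by (rule mult_binomial_dvd_common_multiple[of "2 * n"]) (use cm assms(1) in auto)
  then have "n * ((2 * n) choose n) \<le> D" using Dpos dvd_imp_le by (simp add: mult_2)
  then have "real n * real ((2 * n) choose n) \<le> real D"
    by (metis of_nat_le_iff of_nat_mult)
  moreover have "4 ^ n \<le> 2 * (real n * real ((2 * n) choose n))"
    using central_binomial_lower_bound[OF assms(1)] assms(1) by (simp add: field_simps)
  moreover have "real D \<le> real ((2 * n) ^ N)"
  proof -
    have "D \<le> (\<Prod>q\<in>Q. 2 * n)" unfolding D_def
      by (rule prod_mono) (use e Q_def in auto)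
    also have "\<dots> = (2 * n) ^ card Q" by simp
    also have "\<dots> \<le> (2 * n) ^ N"
    proof (rule power_increasing)
      have "Q \<subseteq> {1..N}" unfolding Q_def using prime_ge_1_nat by auto
      then show "card Q \<le> N" using card_mono[of "{1..N}" Q] by simp
    qed (use assms(1) in simp)
    finally show ?thesis by (simp only: of_nat_le_iff)
  qed
  ultimately have "4 ^ n \<le> 2 * real ((2 * n) ^ N)" by linarith
  then have "real (4 ^ n) \<le> real (2 * (2 * n) ^ N)" by simp
  then show ?thesis by (simp only: of_nat_le_iff)
qed

text \<open>With \<open>N = 2^2^m\<close> and \<open>2 * n = N * N\<close>, the absence of such a
  prime would give \<open>N * N \<le> 1 + 2^(m+1) * N\<close>, but \<open>N\<close> is doubly
  exponential in \<open>m\<close>.\<close>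

lemma prime_between_double_exponentials:
  assumes "2 \<le> m"
  obtains p :: nat where "prime p" "2 ^ 2 ^ m < p" "p \<le> 2 ^ 2 ^ Suc m"
proof (rule ccontr)
  assume "\<not> thesis"
  then have no: "p \<le> 2 ^ 2 ^ m" if "prime p" "p \<le> 2 ^ 2 ^ Suc m" for p :: nat
    using that \<open>\<And>p. prime p \<Longrightarrow> 2 ^ 2 ^ m < p \<Longrightarrow> p \<le> 2 ^ 2 ^ Suc m \<Longrightarrow> thesis\<close> not_le by blast
  define N :: nat where "N = 2 ^ 2 ^ m"
  define n :: nat where "n = 2 ^ (2 ^ Suc m - 1)"
  have n2: "2 * n = 2 ^ 2 ^ Suc m" unfolding n_def
    by (metis power_eq_0_iff power_minus_mult mult.commute not_gr_zero zero_neq_numeral)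
  have NN: "2 * n = N * N" unfolding n2 N_def by (simp add: power_add[symmetric] mult_2)
  have "4 ^ n \<le> 2 * (2 * n) ^ N"
    by (rule no_prime_between_bound) (use no n2 in \<open>auto simp: n_def N_def\<close>)
  also have "\<dots> = 2 ^ Suc (2 ^ Suc m * N)" unfolding n2 by (simp add: power_mult)
  finally have "2 ^ (N * N) \<le> (2::nat) ^ Suc (2 ^ Suc m * N)"
    unfolding NN[symmetric] by (simp add: power_mult)
  then have le: "N * N \<le> Suc (2 ^ Suc m * N)"
    using power_le_imp_le_exp[of "2::nat" "N * N" "Suc (2 ^ Suc m * N)"] by linarith
  \<comment> \<open>Here \<open>2 \<le> m\<close> enters: \<open>N\<close> is at least twice
    \<open>2^(m+1)\<close>, which leaves room for the extra 1 in \<open>le\<close>.\<close>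
  have "Suc (Suc m) \<le> 2 ^ m" using assms by (induction m rule: dec_induct) auto
  then have "2 ^ Suc (Suc m) \<le> N" unfolding N_def by (rule power_increasing) simp
  moreover have "(2::nat) ^ Suc m \<ge> 2 ^ 1" by (rule power_increasing) auto
  ultimately have "2 ^ Suc m + 2 \<le> N"
    unfolding power_Suc[of 2 "Suc m"] power_one_right by linarith
  then have "(2 ^ Suc m + 2) * N \<le> N * N" by (rule mult_le_mono1)
  moreover have "N \<ge> 1" unfolding N_def by simp
  ultimately show False using le by (simp add: algebra_simps)
qed

section \<open>Real fields without a prime root of two\<close>

lemma degree_pos_of_root: "f \<noteq> 0 \<Longrightarrow> poly f x = 0 \<Longrightarrow> 0 < degree f"
  by (metis degree_eq_zeroE gr0I pCons_0_0 poly_const_conv mult_zero_right poly_pCons poly_0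
      add.right_neutral)

text \<open>The convention \<open>x / 0 = 0\<close> lets closure under division be stated
  unconditionally; the other field operations follow from difference and quotient.\<close>

locale subfield_set =
  fixes K :: "'a :: field set"
  assumes one_mem: "1 \<in> K"
    and diff_mem: "x \<in> K \<Longrightarrow> y \<in> K \<Longrightarrow> x - y \<in> K"
    and divide_mem: "x \<in> K \<Longrightarrow> y \<in> K \<Longrightarrow> x / y \<in> K"
begin

lemma zero_mem: "0 \<in> K"
  using diff_mem[OF one_mem one_mem] by simp

lemma uminus_mem: "x \<in> K \<Longrightarrow> - x \<in> K"
  using diff_mem[OF zero_mem] by simp

lemma add_mem: "x \<in> K \<Longrightarrow> y \<in> K \<Longrightarrow> x + y \<in> K"
  using diff_mem[OF _ uminus_mem, of x y] by simp

lemma mult_mem: "x \<in> K \<Longrightarrow> y \<in> K \<Longrightarrow> x * y \<in> K"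
  using divide_mem[OF _ divide_mem[OF one_mem], of x y] by simp

lemma power_mem: "x \<in> K \<Longrightarrow> x ^ n \<in> K"
  by (induction n) (auto intro: one_mem mult_mem)

lemma sum_mem: "(\<And>i. i \<in> I \<Longrightarrow> f i \<in> K) \<Longrightarrow> sum f I \<in> K"
  by (induction I rule: infinite_finite_induct) (auto intro: zero_mem add_mem)

lemma of_nat_mem: "of_nat n \<in> K"
  by (induction n) (auto intro: zero_mem one_mem add_mem)

lemma of_int_mem: "of_int n \<in> K"
  by (cases n) (auto intro: of_nat_mem uminus_mem simp del: of_nat_Suc)

text \<open>Gaussian elimination by induction on the number of equations: the last one either has
  only zero coefficients or supplies a pivot \<open>j0\<close>, whose unknown is eliminated from the
  others.\<close>

lemma homogeneous_system:
  assumes "finite J" and "n < card J" and "\<And>j i. j \<in> J \<Longrightarrow> i < n \<Longrightarrow> a j i \<in> K"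
  shows "\<exists>c. (\<forall>j\<in>J. c j \<in> K) \<and> (\<exists>j\<in>J. c j \<noteq> 0) \<and> (\<forall>i<n. (\<Sum>j\<in>J. c j * a j i) = 0)"
  using assms
proof (induction n arbitrary: J a)
  case 0
  then have "J \<noteq> {}" by auto
  then show ?case by (intro exI[of _ "\<lambda>_. 1"]) (auto intro: one_mem)
next
  case (Suc n)
  show ?case
  proof (cases "\<exists>j0\<in>J. a j0 n \<noteq> 0")
    case False
    have "\<exists>c. (\<forall>j\<in>J. c j \<in> K) \<and> (\<exists>j\<in>J. c j \<noteq> 0) \<and> (\<forall>i<n. (\<Sum>j\<in>J. c j * a j i) = 0)"
      by (rule Suc.IH) (use Suc.prems in auto)
    then show ?thesis using False by (auto simp: less_Suc_eq)
  next
    case True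
    then obtain j0 where j0: "j0 \<in> J" "a j0 n \<noteq> 0" by blast
    define J' where "J' = J - {j0}"
    define b where "b = (\<lambda>j. a j n / a j0 n)"
    have b: "b j \<in> K" if "j \<in> J'" for j
      unfolding b_def using that j0 Suc.prems(3) by (auto simp: J'_def intro!: divide_mem)
    have "\<exists>c. (\<forall>j\<in>J'. c j \<in> K) \<and> (\<exists>j\<in>J'. c j \<noteq> 0)
        \<and> (\<forall>i<n. (\<Sum>j\<in>J'. c j * (a j i - b j * a j0 i)) = 0)"
      by (rule Suc.IH) (use Suc.prems j0 b in \<open>auto simp: J'_def intro!: diff_mem mult_mem\<close>)
    then obtain c where c: "\<And>j. j \<in> J' \<Longrightarrow> c j \<in> K" "\<exists>j\<in>J'. c j \<noteq> 0"
      "\<And>i. i < n \<Longrightarrow> (\<Sum>j\<in>J'. c j * (a j i - b j * a j0 i)) = 0" by blast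
    \<comment> \<open>The pivot's unknown gets the value forced by equation
      \<open>n\<close>.\<close>
    define s where "s = - (\<Sum>j\<in>J'. c j * b j)"
    define d where "d = c(j0 := s)"
    have split: "(\<Sum>j\<in>J. d j * a j i) = (\<Sum>j\<in>J'. c j * (a j i - b j * a j0 i))" for i
    proof -
      have "(\<Sum>j\<in>J. d j * a j i) = s * a j0 i + (\<Sum>j\<in>J'. c j * a j i)"
        using j0 Suc.prems(1) by (auto simp: J'_def d_def sum.remove[of J j0] intro!: sum.cong)
      also have "\<dots> = (\<Sum>j\<in>J'. c j * (a j i - b j * a j0 i))"
        by (simp add: s_def sum_distrib_left sum_subtractf algebra_simps)
      finally show ?thesis .
    qed
    have "(\<Sum>j\<in>J. d j * a j i) = 0" if "i < Suc n" for i
    proof (cases "i = n")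
      case True
      show ?thesis unfolding split True using j0 by (simp add: b_def)
    next
      case False
      then show ?thesis unfolding split using c(3) that by simp
    qed
    moreover have "s \<in> K" unfolding s_def by (intro uminus_mem sum_mem mult_mem c(1) b)
    ultimately show ?thesis
      using c(1,2) by (intro exI[of _ d]) (auto simp: d_def J'_def)
  qed
qed

section \<open>Polynomials over a subfield and simple extensions\<close>

definition poly_over :: "'a poly \<Rightarrow> bool" where
  "poly_over f \<longleftrightarrow> (\<forall>i. coeff f i \<in> K)"

lemma poly_over_const: "c \<in> K \<Longrightarrow> poly_over [:c:]"
  by (auto simp: poly_over_def coeff_pCons zero_mem split: nat.split)

lemma poly_over_X: "poly_over [:0, 1:]"
  by (auto simp: poly_over_def coeff_pCons zero_mem one_mem split: nat.split)

lemma poly_over_monom: "c \<in> K \<Longrightarrow> poly_over (monom c n)"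
  by (auto simp: poly_over_def zero_mem)

lemma poly_over_diff: "poly_over f \<Longrightarrow> poly_over g \<Longrightarrow> poly_over (f - g)"
  by (auto simp: poly_over_def diff_mem)

lemma poly_over_mult: "poly_over f \<Longrightarrow> poly_over g \<Longrightarrow> poly_over (f * g)"
  by (auto simp: poly_over_def coeff_mult intro!: sum_mem mult_mem)

lemma poly_over_power: "poly_over f \<Longrightarrow> poly_over (f ^ n)"
  by (induction n) (auto intro: poly_over_mult simp: poly_over_const one_mem one_pCons)

text \<open>Long division uses only field operations on coefficients, the divisor being the leading
  coefficient of \<open>g\<close>.\<close>

lemma poly_over_mod:
  assumes "poly_over g" "poly_over f"
  shows "poly_over (f mod g)"
proof (cases "g = 0")
  case True
  then show ?thesis using assms by simp
next
  case False
  show ?thesis using assms(2)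
  proof (induction f)
    case 0
    then show ?case by simp
  next
    case (pCons a f)
    have co: "coeff (pCons a f) i \<in> K" for i using pCons.prems by (simp add: poly_over_def)
    have "a \<in> K" using co[of 0] by simp
    moreover have "poly_over f" unfolding poly_over_def using co[of "Suc i" for i] by simp
    ultimately have p: "poly_over (pCons a (f mod g))"
      using pCons.IH by (auto simp: poly_over_def coeff_pCons split: nat.split)
    then show ?case unfolding mod_pCons[OF False]
      using assms(1) unfolding poly_over_def coeff_diff coeff_smult
      by (blast intro: diff_mem mult_mem divide_mem)
  qed
qed

text \<open>
  With \<open>n\<close> the degree of \<open>f\<close>, the \<open>n + 1\<close> elements \<open>u\<^sup>j v\<^sup>n\<^sup>-\<^sup>j\<close>, where \<open>u\<close> and \<open>v\<close> are the values of
  \<open>g\<close> and \<open>h\<close>, lie in the span of the first \<open>n\<close> powers of \<open>\<beta>\<close>.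
\<close>

lemma algebraic_quotient:
  assumes f: "poly_over f" "f \<noteq> 0" "poly f \<beta> = 0"
    and g: "poly_over g" and h: "poly_over h" "poly h \<beta> \<noteq> 0"
  obtains r where "poly_over r" "r \<noteq> 0" "degree r \<le> degree f" "poly r (poly g \<beta> / poly h \<beta>) = 0"
proof -
  define n where "n = degree f"
  define w where "w = (\<lambda>j. (g ^ j * h ^ (n - j)) mod f)"
  have "n > 0" unfolding n_def using degree_pos_of_root f(2,3) .
  have w_deg: "degree (w j) < n" for j
    unfolding w_def n_def using degree_mod_less'[of f] f(2) \<open>n > 0\<close>[unfolded n_def]
    by (metis degree_0)
  have w_over: "poly_over (w j)" for j
    unfolding w_def by (intro poly_over_mod f poly_over_mult poly_over_power g h)
  have w_val: "poly (w j) \<beta> = poly g \<beta> ^ j * poly h \<beta> ^ (n - j)" for j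
  proof -
    have "poly (g ^ j * h ^ (n - j)) \<beta> = poly (w j) \<beta>"
      unfolding w_def using poly_mod f(3) by metis
    then show ?thesis by simp
  qed
  \<comment> \<open>There are \<open>n + 1\<close> unknowns \<open>c j\<close>, and each power of
    \<beta> below the \<open>n\<close>-th contributes one equation.\<close>
  have "\<exists>c. (\<forall>j\<in>{..n}. c j \<in> K) \<and> (\<exists>j\<in>{..n}. c j \<noteq> 0)
      \<and> (\<forall>i<n. (\<Sum>j\<in>{..n}. c j * coeff (w j) i) = 0)"
    by (rule homogeneous_system) (use w_over in \<open>auto simp: poly_over_def\<close>)
  then obtain c where c: "\<And>j. j \<le> n \<Longrightarrow> c j \<in> K" "\<exists>j\<le>n. c j \<noteq> 0"
    "\<And>i. i < n \<Longrightarrow> (\<Sum>j\<le>n. c j * coeff (w j) i) = 0" by (metis atMost_iff)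
  define r where "r = (\<Sum>j\<le>n. monom (c j) j)"
  have coeff_r: "coeff r i = (if i \<le> n then c i else 0)" for i
    unfolding r_def by (simp add: coeff_sum)
  have "(\<Sum>j\<le>n. smult (c j) (w j)) = 0"
  proof (rule poly_eqI)
    fix i
    show "coeff (\<Sum>j\<le>n. smult (c j) (w j)) i = coeff 0 i"
    proof (cases "i < n")
      case False
      then have "coeff (w j) i = 0" for j using w_deg[of j] by (simp add: coeff_eq_0)
      then show ?thesis by (simp add: coeff_sum)
    qed (simp add: coeff_sum c)
  qed
  then have "(\<Sum>j\<le>n. c j * poly (w j) \<beta>) = 0"
    by (metis (no_types, lifting) poly_0 poly_smult poly_sum sum.cong)
  \<comment> \<open>Multiplication by the \<open>n\<close>-th power of the denominator turns
    \<open>r\<close> into its homogeneous form.\<close>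
  moreover have "(\<Sum>j\<le>n. c j * poly (w j) \<beta>) = poly h \<beta> ^ n * poly r (poly g \<beta> / poly h \<beta>)"
    unfolding r_def poly_sum poly_monom sum_distrib_left w_val
  proof (rule sum.cong[OF refl])
    fix j assume "j \<in> {..n}"
    then have "poly h \<beta> ^ n = poly h \<beta> ^ j * poly h \<beta> ^ (n - j)"
      by (simp add: power_add[symmetric])
    then show "c j * (poly g \<beta> ^ j * poly h \<beta> ^ (n - j))
        = poly h \<beta> ^ n * (c j * (poly g \<beta> / poly h \<beta>) ^ j)"
      using h(2) by (simp add: power_divide)
  qed
  ultimately have "poly r (poly g \<beta> / poly h \<beta>) = 0" using h(2) by simp
  moreover have "r \<noteq> 0" using c(2) coeff_r by (metis coeff_0)
  moreover have "poly_over r" unfolding poly_over_def coeff_r using c(1) zero_mem by auto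
  moreover have "degree r \<le> degree f"
    by (rule degree_le) (simp add: coeff_r n_def[symmetric])
  ultimately show thesis using that by blast
qed

text \<open>This set is the field K(\<beta>); a quotient whose denominator vanishes at \<beta> is 0
  by convention and does no harm.\<close>

lemma adjoin_subfield:
  "subfield_set {poly g \<beta> / poly h \<beta> | g h. poly_over g \<and> poly_over h}" (is "subfield_set ?L")
proof
  have intro: "poly g \<beta> / poly h \<beta> \<in> ?L" if "poly_over g" "poly_over h" for g h
    using that by blast
  show "1 \<in> ?L" using intro[OF poly_over_const poly_over_const, of 1 1] one_mem by simp
  fix x y assume "x \<in> ?L" "y \<in> ?L"
  then obtain g h g' h' where x: "x = poly g \<beta> / poly h \<beta>" "poly_over g" "poly_over h"
    and y: "y = poly g' \<beta> / poly h' \<beta>" "poly_over g'" "poly_over h'" by blast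
  have "poly (g * h') \<beta> / poly (h * g') \<beta> \<in> ?L"
    by (rule intro; intro poly_over_mult x y)
  then show "x / y \<in> ?L" unfolding x y by (simp add: divide_divide_eq_left divide_divide_eq_right mult.commute)
  show "x - y \<in> ?L"
  proof (cases "poly h \<beta> = 0 \<or> poly h' \<beta> = 0")
    case False
    have "poly (g * h' - g' * h) \<beta> / poly (h * h') \<beta> \<in> ?L"
      by (rule intro; intro poly_over_mult poly_over_diff x y)
    then show ?thesis unfolding x y using False by (simp add: field_simps)
  next
    \<comment> \<open>One of \<open>x\<close> and \<open>y\<close> is a quotient by 0 and hence
      0.\<close>
    case True
    have "poly (0 - g') \<beta> / poly h' \<beta> \<in> ?L"
      by (rule intro; intro poly_over_diff x y) (simp add: poly_over_def zero_mem)
    then have "- y \<in> ?L" unfolding y by simp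
    moreover have "x - y = x \<or> x - y = - y" using True unfolding x y by auto
    ultimately show ?thesis using \<open>x \<in> ?L\<close> by presburger
  qed
qed

end

section \<open>Degree of a prime root over a real field\<close>

lemma map_poly_of_real_mult:
  "map_poly of_real (f * g) = map_poly of_real f * (map_poly of_real g :: 'a :: {real_algebra_1, comm_semiring_1} poly)"
  by (rule poly_eqI) (simp add: coeff_map_poly coeff_mult)

text \<open>Over the complex numbers \<open>f\<close> splits, and its constant coefficient is the
  leading one times the product of the negated roots.\<close>

lemma norm_coeff_0_of_roots:
  fixes f :: "complex poly"
  assumes "\<And>z. poly f z = 0 \<Longrightarrow> norm z = a"
  shows "norm (coeff f 0) = norm (lead_coeff f) * a ^ degree f"
proof (cases "f = 0")
  case False
  obtain root where f: "smult (lead_coeff f) (\<Prod>i<degree f. [:- root i, 1:]) = f"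
    by (rule complex_poly_decompose')
  have val: "poly f z = lead_coeff f * (\<Prod>i<degree f. z - root i)" for z
    by (subst f[symmetric]) (simp add: poly_prod)
  have "norm (root i) = a" if "i < degree f" for i
    by (rule assms) (use that in \<open>auto simp: val\<close>)
  then have "(\<Prod>i<degree f. norm (root i)) = a ^ degree f" by simp
  moreover have "norm (coeff f 0) = norm (lead_coeff f) * (\<Prod>i<degree f. norm (root i))"
    unfolding poly_0_coeff_0[symmetric] val by (simp add: norm_mult flip: prod_norm)
  ultimately show ?thesis by simp
qed simp

text \<open>
  A minimal polynomial \<open>g\<close> of \<open>\<alpha>\<close> divides \<open>X\<^sup>p - \<alpha>\<^sup>p\<close>, so all its complex roots have modulus \<open>\<alpha>\<close> and
  its constant coefficient is \<open>\<plusminus>\<alpha>\<^sup>k\<close>, where \<open>k\<close> is its degree.  As \<open>k\<close> and \<open>p\<close> are coprime, \<open>\<alpha>\<close> is a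
  quotient of powers of \<open>\<alpha>\<^sup>k\<close> and \<open>\<alpha>\<^sup>p\<close>.
\<close>

lemma prime_root_of_low_degree:
  fixes K :: "real set"
  assumes "subfield_set K" and p: "prime p" and a: "0 < \<alpha>" "\<alpha> ^ p \<in> K"
    and r: "subfield_set.poly_over K r" "r \<noteq> 0" "poly r \<alpha> = 0" "degree r < p"
  shows "\<alpha> \<in> K"
proof -
  interpret subfield_set K by fact
  define P where "P = (\<lambda>g. poly_over g \<and> g \<noteq> 0 \<and> poly g \<alpha> = 0)"
  obtain g where g: "P g" and min: "\<And>h. P h \<Longrightarrow> degree g \<le> degree h"
    using ex_has_least_nat[of P r degree] r unfolding P_def by blast
  define k where "k = degree g"
  have g': "poly_over g" "g \<noteq> 0" "poly g \<alpha> = 0" using g unfolding P_def by auto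
  have "k < p" using min[of r] r unfolding P_def k_def by auto
  have "k > 0" unfolding k_def using degree_pos_of_root g'(2,3) .
  define f where "f = monom 1 p - [:\<alpha> ^ p:]"
  have f_val: "poly f \<alpha> = 0" unfolding f_def by (simp add: poly_monom)
  have f_over: "poly_over f"
    unfolding f_def by (intro poly_over_diff poly_over_monom poly_over_const one_mem a)
  have "f mod g = 0"
  proof (rule ccontr)
    assume nz: "f mod g \<noteq> 0"
    have "poly (f mod g) \<alpha> = 0" using poly_mod[OF g'(3)] f_val by simp
    then have "P (f mod g)" unfolding P_def using nz poly_over_mod[OF g'(1) f_over] by simp
    then show False using min degree_mod_less'[OF g'(2) nz] by fastforce
  qed
  then obtain q where q: "f = g * q" by (auto simp: mod_eq_0_iff_dvd)
  define G :: "complex poly" where "G = map_poly of_real g"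
  have G: "degree G = k" "coeff G i = of_real (coeff g i)" for i
    unfolding G_def k_def by (simp_all add: coeff_map_poly degree_map_poly)
  have "norm z = \<alpha>" if "poly G z = 0" for z
  proof -
    have "map_poly of_real f = monom 1 p - [:complex_of_real (\<alpha> ^ p):]"
      unfolding f_def by (rule poly_eqI) (simp add: coeff_map_poly coeff_pCons split: nat.split)
    moreover have "poly (map_poly of_real f) z = 0"
      unfolding q map_poly_of_real_mult using that G_def by simp
    ultimately have "z ^ p = complex_of_real (\<alpha> ^ p)" by (simp add: poly_monom)
    then have "norm z ^ p = \<alpha> ^ p"
      using a(1) by (metis abs_of_pos norm_of_real norm_power zero_less_power)
    then show ?thesis using a(1) p prime_gt_0_nat by (metis less_imp_le norm_ge_zero power_eq_imp_eq_base)
  qed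
  from norm_coeff_0_of_roots[of G, OF this]
  have "\<bar>coeff g 0\<bar> = \<bar>coeff g k\<bar> * \<alpha> ^ k" unfolding G(1) by (simp add: G(2))
  moreover have "coeff g k \<noteq> 0" unfolding k_def using g'(2) by simp
  ultimately have "\<alpha> ^ k = \<bar>coeff g 0 / coeff g k\<bar>" by (simp add: field_simps abs_divide)
  also have "\<dots> \<in> K"
    using g'(1) divide_mem uminus_mem unfolding poly_over_def abs_if by presburger
  finally have ak: "\<alpha> ^ k \<in> K" .
  have "coprime k p"
    using p \<open>0 < k\<close> \<open>k < p\<close> by (metis coprime_commute nat_dvd_not_less prime_imp_coprime_nat)
  then obtain x y where xy: "k * x = p * y + 1"
    using bezout_nat[of k p] \<open>0 < k\<close> by (auto simp: coprime_iff_gcd_eq_1)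
  have "(\<alpha> ^ k) ^ x = (\<alpha> ^ p) ^ y * \<alpha>"
    unfolding power_mult[symmetric] xy by simp
  then have "\<alpha> = (\<alpha> ^ k) ^ x / (\<alpha> ^ p) ^ y" using a(1) by simp
  also have "\<dots> \<in> K" by (intro divide_mem power_mem ak a)
  finally show ?thesis .
qed

section \<open>Maximal subfields avoiding a given element\<close>

lemma maximal_subfield_avoiding:
  fixes \<alpha> :: "'a :: field_char_0"
  assumes "\<alpha> \<notin> \<rat>"
  obtains K where "subfield_set K" "\<alpha> \<notin> K" "\<And>L. subfield_set L \<Longrightarrow> K \<subseteq> L \<Longrightarrow> L \<noteq> K \<Longrightarrow> \<alpha> \<in> L"
proof -
  define A where "A = {L. subfield_set L \<and> \<alpha> \<notin> L}"
  have Rats: "subfield_set (\<rat> :: 'a set)" by standard auto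
  have "\<exists>M\<in>A. \<forall>X\<in>A. M \<subseteq> X \<longrightarrow> X = M"
  proof (rule subset_Zorn)
    fix C assume chain: "subset.chain A C"
    show "\<exists>U\<in>A. \<forall>X\<in>C. X \<subseteq> U"
    proof (cases "C = {}")
      case True
      \<comment> \<open>The empty chain is bounded by the rationals, which avoid \<alpha> by
        assumption.\<close>
      then show ?thesis using Rats assms unfolding A_def by auto
    next
      case False
      have both: "\<exists>X\<in>C. x \<in> X \<and> y \<in> X" if "x \<in> \<Union>C" "y \<in> \<Union>C" for x y
        using chain that unfolding subset_chain_def by blast
      have sub: "subfield_set X" if "X \<in> C" for X
        using chain that unfolding subset_chain_def A_def by blast
      have "subfield_set (\<Union>C)"
      proof
        show "1 \<in> \<Union>C" using False sub subfield_set.one_mem by blast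
        fix x y assume "x \<in> \<Union>C" "y \<in> \<Union>C"
        then show "x - y \<in> \<Union>C" "x / y \<in> \<Union>C"
          using both sub subfield_set.diff_mem subfield_set.divide_mem by blast+
      qed
      moreover have "\<alpha> \<notin> \<Union>C" using chain unfolding subset_chain_def A_def by blast
      ultimately show ?thesis unfolding A_def by blast
    qed
  qed
  then show thesis using that unfolding A_def by blast
qed

text \<open>The exponents of 2 on both sides of \<open>m ^ p = 2 * n ^ p\<close> differ by 1 modulo
  \<open>p\<close>.\<close>

lemma prime_root_two_irrational:
  assumes "2 \<le> p" "x ^ p = 2"
  shows "(x :: real) \<notin> \<rat>"
proof
  assume "x \<in> \<rat>"
  then obtain m n where mn: "n \<noteq> 0" "\<bar>x\<bar> = real m / real n" by (rule Rats_abs_nat_div_natE)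
  have "\<bar>x\<bar> ^ p = 2" using assms(2) by (simp flip: power_abs)
  then have "real m ^ p = 2 * real n ^ p" using mn by (simp add: power_divide field_simps)
  then have eq: "m ^ p = 2 * n ^ p"
    by (metis (mono_tags, lifting) of_nat_eq_iff of_nat_mult of_nat_numeral of_nat_power)
  have "m \<noteq> 0" using eq mn(1) assms(1) by (metis mult_eq_0_iff power_not_zero power_0_left not_numeral_le_zero zero_neq_numeral)
  have "p * multiplicity 2 m = multiplicity 2 (m ^ p)"
    using \<open>m \<noteq> 0\<close> by (simp add: prime_elem_multiplicity_power_distrib)
  also have "\<dots> = 1 + p * multiplicity 2 n"
    unfolding eq using mn(1) by (simp add: prime_elem_multiplicity_mult_distrib prime_elem_multiplicity_power_distrib)
  finally have "p dvd 1 + p * multiplicity 2 n" by (metis dvd_triv_left)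
  then have "p dvd 1" by (metis dvd_add_left_iff dvd_triv_left)
  then show False using assms(1) by simp
qed

lemma almost_real_closed_subfield:
  assumes p: "prime p" and \<alpha>: "0 < \<alpha>" "\<alpha> ^ p = 2"
  obtains K :: "real set" where "subfield_set K" "\<alpha> \<notin> K"
    "\<And>f \<beta>. subfield_set.poly_over K f \<Longrightarrow> f \<noteq> 0 \<Longrightarrow> degree f < p \<Longrightarrow> poly f \<beta> = 0 \<Longrightarrow> \<beta> \<in> K"
proof -
  obtain K where K: "subfield_set K" "\<alpha> \<notin> K"
    and max: "\<And>L. subfield_set L \<Longrightarrow> K \<subseteq> L \<Longrightarrow> L \<noteq> K \<Longrightarrow> \<alpha> \<in> L"
    using maximal_subfield_avoiding prime_root_two_irrational prime_ge_2_nat p \<alpha>(2) by metis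
  interpret subfield_set K by fact
  have "\<beta> \<in> K" if f: "poly_over f" "f \<noteq> 0" "degree f < p" "poly f \<beta> = 0" for f \<beta>
  proof (rule ccontr)
    assume "\<beta> \<notin> K"
    define L where "L = {poly g \<beta> / poly h \<beta> | g h. poly_over g \<and> poly_over h}"
    have intro: "poly g \<beta> / poly h \<beta> \<in> L" if "poly_over g" "poly_over h" for g h
      using that unfolding L_def by blast
    have one: "poly_over 1" using poly_over_const[OF one_mem] by (simp add: one_pCons)
    have "x \<in> L" if "x \<in> K" for x
      using intro[OF poly_over_const[OF that] one] by simp
    moreover have "\<beta> \<in> L" using intro[OF poly_over_X one] by simp
    \<comment> \<open>K(\<beta>) properly extends \<open>K\<close>, so maximality puts \<alpha> into
      it.\<close>
    ultimately have "\<alpha> \<in> L"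
      using max[of L] adjoin_subfield[of \<beta>] \<open>\<beta> \<notin> K\<close> unfolding L_def[symmetric] by blast
    then obtain g h where gh: "\<alpha> = poly g \<beta> / poly h \<beta>" "poly_over g" "poly_over h"
      unfolding L_def by blast
    moreover have "poly h \<beta> \<noteq> 0" using gh(1) \<alpha>(1) by auto
    ultimately obtain r where "poly_over r" "r \<noteq> 0" "degree r \<le> degree f" "poly r \<alpha> = 0"
      using algebraic_quotient[OF f(1,2,4)] by metis
    moreover have "\<alpha> ^ p \<in> K" using of_nat_mem[of 2] \<alpha>(2) by simp
    ultimately have "\<alpha> \<in> K"
      using prime_root_of_low_degree[OF K(1) p \<alpha>(1)] f(3) by simp
    then show False using K(2) by blast
  qed
  then show thesis using that K by blast
qed

text \<open>The intermediate value theorem applies since the signs far out on both sides differ;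
  passing to \<open>- f\<close> makes the leading coefficient positive.\<close>

lemma real_poly_odd_degree_root:
  fixes f :: "real poly"
  assumes "odd (degree f)"
  shows "\<exists>x. poly f x = 0"
proof -
  have pos: "\<exists>x. poly f x = 0" if f: "odd (degree f)" "lead_coeff f > 0" for f :: "real poly"
  proof -
    obtain a where a: "\<And>x. x \<ge> a \<Longrightarrow> poly f x \<ge> lead_coeff f" using poly_pinfty_gt_lc[OF f(2)] by blast
    \<comment> \<open>This is -f(-X). Its degree is odd, so its leading coefficient is that of
      \<open>f\<close>, and its growth at plus infinity controls \<open>f\<close> at minus
      infinity.\<close>
    define g where "g = - pcompose f [:0, -1:]"
    have "lead_coeff g = lead_coeff f" unfolding g_def using f(1) by (simp add: lead_coeff_comp)
    moreover have "poly g x = - poly f (- x)" for x unfolding g_def by (simp add: poly_pcompose)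
    ultimately obtain b where b: "\<And>x. x \<ge> b \<Longrightarrow> - poly f (- x) \<ge> lead_coeff f"
      using poly_pinfty_gt_lc[of g] f(2) by auto
    \<comment> \<open>The 1 ensures \<open>- c < c\<close>.\<close>
    define c where "c = max 1 (max a b)"
    have "poly f (- c) < 0" "0 < poly f c" using a[of c] b[of c] f(2) by (simp_all add: c_def le_max_iff_disj)
    then show ?thesis using poly_IVT_pos[of "- c" c f] unfolding c_def by force
  qed
  have "lead_coeff f \<noteq> 0" using assms by auto
  then show ?thesis using pos[of f] pos[of "- f"] assms by (cases "lead_coeff f > 0") (auto simp: not_less le_less)
qed

section \<open>Semantics and soundness\<close>

primrec tval :: "(nat \<Rightarrow> 'a :: comm_semiring_1) \<Rightarrow> trm \<Rightarrow> 'a" where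
  "tval e (Var n) = e n"
| "tval e Zer = 0"
| "tval e Unity = 1"
| "tval e (Add s t) = tval e s + tval e t"
| "tval e (Mul s t) = tval e s * tval e t"

text \<open>Only quantifiers see the domain \<open>K\<close>, while terms are evaluated in the
  ambient type; thus a subfield obtained inside a proof serves as a structure.\<close>

primrec sat :: "'a set \<Rightarrow> (nat \<Rightarrow> 'a :: comm_semiring_1) \<Rightarrow> fm \<Rightarrow> bool" where
  "sat K e (Eq s t) \<longleftrightarrow> tval e s = tval e t"
| "sat K e Bot \<longleftrightarrow> False"
| "sat K e (Imp \<phi> \<psi>) \<longleftrightarrow> (sat K e \<phi> \<longrightarrow> sat K e \<psi>)"
| "sat K e (And \<phi> \<psi>) \<longleftrightarrow> sat K e \<phi> \<and> sat K e \<psi>"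
| "sat K e (Or \<phi> \<psi>) \<longleftrightarrow> sat K e \<phi> \<or> sat K e \<psi>"
| "sat K e (All x \<phi>) \<longleftrightarrow> (\<forall>d\<in>K. sat K (e(x := d)) \<phi>)"
| "sat K e (Ex x \<phi>) \<longleftrightarrow> (\<exists>d\<in>K. sat K (e(x := d)) \<phi>)"

definition true_in :: "'a :: comm_semiring_1 set \<Rightarrow> fm \<Rightarrow> bool" where
  "true_in K \<phi> \<longleftrightarrow> (\<forall>e. range e \<subseteq> K \<longrightarrow> sat K e \<phi>)"

definition valid_in :: "'a :: comm_semiring_1 set \<Rightarrow> sequent \<Rightarrow> bool" where
  "valid_in K s \<longleftrightarrow> (\<forall>e. range e \<subseteq> K \<longrightarrow> (\<forall>\<gamma>\<in>set (fst s). sat K e \<gamma>) \<longrightarrow> sat K e (snd s))"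

lemma range_fun_upd_subset: "range e \<subseteq> K \<Longrightarrow> d \<in> K \<Longrightarrow> range (e(x := d)) \<subseteq> K"
  by auto

lemma tval_cong: "(\<And>n. n \<in> tvars t \<Longrightarrow> e n = e' n) \<Longrightarrow> tval e t = tval e' t"
  by (induction t) (simp, simp, simp, force, force)

lemma sat_cong: "(\<And>n. n \<in> fv \<phi> \<Longrightarrow> e n = e' n) \<Longrightarrow> sat K e \<phi> = sat K e' \<phi>"
proof (induction \<phi> arbitrary: e e')
  case (Eq s t)
  have "tval e s = tval e' s" "tval e t = tval e' t"
    by (rule tval_cong, simp add: Eq.prems)+
  then show ?case by simp
next
  case (Imp \<phi> \<psi>)
  have "sat K e \<phi> = sat K e' \<phi>" "sat K e \<psi> = sat K e' \<psi>"
    by (rule Imp.IH, simp add: Imp.prems)+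
  then show ?case by simp
next
  case (And \<phi> \<psi>)
  have "sat K e \<phi> = sat K e' \<phi>" "sat K e \<psi> = sat K e' \<psi>"
    by (rule And.IH, simp add: And.prems)+
  then show ?case by simp
next
  case (Or \<phi> \<psi>)
  have "sat K e \<phi> = sat K e' \<phi>" "sat K e \<psi> = sat K e' \<psi>"
    by (rule Or.IH, simp add: Or.prems)+
  then show ?case by simp
next
  case (All x \<phi>)
  have "sat K (e(x := d)) \<phi> = sat K (e'(x := d)) \<phi>" for d
    by (rule All.IH) (simp add: All.prems)
  then show ?case by simp
next
  case (Ex x \<phi>)
  have "sat K (e(x := d)) \<phi> = sat K (e'(x := d)) \<phi>" for d
    by (rule Ex.IH) (simp add: Ex.prems)
  then show ?case by simp
qed simp

lemma sat_fun_upd_fresh: "x \<notin> fv \<phi> \<Longrightarrow> sat K (e(x := d)) \<phi> = sat K e \<phi>"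
  by (rule sat_cong) auto

lemma tval_fun_upd_fresh: "x \<notin> tvars t \<Longrightarrow> tval (e(x := d)) t = tval e t"
  by (rule tval_cong) auto

lemma tsubst_fresh: "x \<notin> tvars s \<Longrightarrow> tsubst x t s = s"
  by (induction s) auto

lemma subst_fresh: "x \<notin> fv \<phi> \<Longrightarrow> subst x t \<phi> = \<phi>"
  by (induction \<phi>) (auto simp: tsubst_fresh)

lemma tval_tsubst: "tval e (tsubst x t s) = tval (e(x := tval e t)) s"
  by (induction s) auto

text \<open>If \<open>x\<close> is not free in a quantified formula, \<open>free_for\<close> says
  nothing about the body, but then neither the substitution nor the update has any effect.\<close>

lemma sat_subst: "free_for t x \<phi> \<Longrightarrow> sat K e (subst x t \<phi>) = sat K (e(x := tval e t)) \<phi>"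
proof (induction \<phi> arbitrary: e)
  case (All y \<phi>)
  show ?case
  proof (cases "x \<in> fv (All y \<phi>)")
    case False
    then show ?thesis by (simp only: subst_fresh sat_fun_upd_fresh not_False_eq_True)
  next
    case True
    then have y: "x \<noteq> y" "y \<notin> tvars t" "free_for t x \<phi>" using All.prems by auto
    have "sat K (e(y := d)) (subst x t \<phi>) = sat K (e(x := tval e t, y := d)) \<phi>" for d
      unfolding All.IH[OF y(3)] tval_fun_upd_fresh[OF y(2)] fun_upd_twist[OF y(1)] ..
    then show ?thesis using y(1) by (simp add: fun_upd_def)
  qed
next
  case (Ex y \<phi>)
  show ?case
  proof (cases "x \<in> fv (Ex y \<phi>)")
    case False
    then show ?thesis by (simp only: subst_fresh sat_fun_upd_fresh not_False_eq_True)
  next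
    case True
    then have y: "x \<noteq> y" "y \<notin> tvars t" "free_for t x \<phi>" using Ex.prems by auto
    have "sat K (e(y := d)) (subst x t \<phi>) = sat K (e(x := tval e t, y := d)) \<phi>" for d
      unfolding Ex.IH[OF y(3)] tval_fun_upd_fresh[OF y(2)] fun_upd_twist[OF y(1)] ..
    then show ?thesis using y(1) by (simp add: fun_upd_def)
  qed
qed (auto simp: tval_tsubst)

text \<open>Handles the eigenvariables of \<open>AllI\<close> and \<open>ExE\<close>; the case
  \<open>y = x\<close> is included.\<close>

lemma sat_rename:
  assumes "free_for (Var y) x \<phi>" "y \<notin> fv \<phi> - {x}"
  shows "sat K (e(y := d)) (subst x (Var y) \<phi>) = sat K (e(x := d)) \<phi>"
proof -
  have "sat K (e(y := d)) (subst x (Var y) \<phi>) = sat K (e(y := d, x := d)) \<phi>"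
    using sat_subst[OF assms(1), of K "e(y := d)"] by simp
  also have "\<dots> = sat K (e(x := d)) \<phi>"
    by (rule sat_cong) (use assms(2) in auto)
  finally show ?thesis .
qed

text \<open>Truth is demanded only of an axiom that is the conclusion of this very inference, so
  other members of \<open>T\<close> may fail in \<open>K\<close>.\<close>

lemma infer_sound:
  fixes K :: "'a :: comm_semiring_1 set"
  assumes "infer T P s"
    and closed: "\<And>e t. range e \<subseteq> K \<Longrightarrow> tval e t \<in> K"
    and P: "\<And>s. s \<in> P \<Longrightarrow> valid_in K s"
    and ax: "snd s \<in> T \<Longrightarrow> true_in K (snd s)"
  shows "valid_in K s"
proof -
  have v: "\<forall>\<gamma>\<in>set (fst s). sat K e \<gamma> \<Longrightarrow> sat K e (snd s)" if "s \<in> P" "range e \<subseteq> K" for s e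
    using P[OF that(1)] that(2) unfolding valid_in_def by blast
  have "sat K e (snd s)" if e: "range e \<subseteq> K" and \<Gamma>: "\<forall>\<gamma>\<in>set (fst s). sat K e \<gamma>" for e
    using assms(1)
  proof cases
    case (Axiom \<phi> \<Gamma>)
    then show ?thesis using ax e by (simp add: true_in_def)
  next
    case (Assume \<phi> \<Gamma>)
    then show ?thesis using \<Gamma> by simp
  next
    case (Weaken \<Gamma> \<phi> \<Delta>)
    then show ?thesis using v[OF Weaken(2) e] \<Gamma> by auto
  next
    case (ImpI \<phi> \<Gamma> \<psi>)
    then show ?thesis using v[OF ImpI(2) e] \<Gamma> by auto
  next
    case (ImpE \<Gamma> \<phi> \<psi>)
    then show ?thesis using v[OF ImpE(2) e] v[OF ImpE(3) e] \<Gamma> by auto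
  next
    case (AndI \<Gamma> \<phi> \<psi>)
    then show ?thesis using v[OF AndI(2) e] v[OF AndI(3) e] \<Gamma> by auto
  next
    case (AndE1 \<Gamma> \<phi> \<psi>)
    then show ?thesis using v[OF AndE1(2) e] \<Gamma> by auto
  next
    case (AndE2 \<Gamma> \<phi> \<psi>)
    then show ?thesis using v[OF AndE2(2) e] \<Gamma> by auto
  next
    case (OrI1 \<Gamma> \<phi> \<psi>)
    then show ?thesis using v[OF OrI1(2) e] \<Gamma> by auto
  next
    case (OrI2 \<Gamma> \<psi> \<phi>)
    then show ?thesis using v[OF OrI2(2) e] \<Gamma> by auto
  next
    case (OrE \<Gamma> \<phi> \<psi> \<chi>)
    then show ?thesis using v[OF OrE(2) e] v[OF OrE(3) e] v[OF OrE(4) e] \<Gamma> by auto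
  next
    case (Classical \<phi> \<Gamma>)
    have "sat K e \<phi>"
    proof (rule ccontr)
      assume "\<not> sat K e \<phi>"
      then show False using v[OF Classical(2) e] \<Gamma> Classical(1) by simp
    qed
    then show ?thesis using Classical(1) by simp
  next
    case (AllI \<Gamma> x y \<phi>)
    have "sat K (e(x := d)) \<phi>" if d: "d \<in> K" for d
    proof -
      have "sat K (e(y := d)) \<gamma>" if "\<gamma> \<in> set \<Gamma>" for \<gamma>
        using \<Gamma> AllI(1,4) that by (auto simp: sat_fun_upd_fresh)
      then have "sat K (e(y := d)) (subst x (Var y) \<phi>)"
        using v[OF AllI(2) range_fun_upd_subset[OF e d]] by simp
      then show ?thesis using sat_rename[OF AllI(3), of K e d] AllI(4) by simp
    qed
    then show ?thesis using AllI(1) by simp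
  next
    case (AllE \<Gamma> x \<phi> t)
    then show ?thesis using v[OF AllE(2) e] \<Gamma> closed[OF e] by (auto simp: sat_subst)
  next
    case (ExI \<Gamma> x t \<phi>)
    then show ?thesis using v[OF ExI(2) e] \<Gamma> closed[OF e] by (auto simp: sat_subst)
  next
    case (ExE \<Gamma> x \<phi> y \<chi>)
    obtain d where d: "d \<in> K" "sat K (e(x := d)) \<phi>"
      using v[OF ExE(2) e] \<Gamma> ExE(1) by auto
    have "sat K (e(y := d)) \<gamma>" if "\<gamma> \<in> set \<Gamma>" for \<gamma>
      using \<Gamma> ExE(1,5) that by (auto simp: sat_fun_upd_fresh)
    moreover have "sat K (e(y := d)) (subst x (Var y) \<phi>)"
      using sat_rename[OF ExE(4), of K e d] ExE(5) d(2) by simp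
    ultimately have "sat K (e(y := d)) \<chi>"
      using v[OF ExE(3) range_fun_upd_subset[OF e d(1)]] by simp
    then show ?thesis using ExE(1,5) by (simp add: sat_fun_upd_fresh)
  next
    case (EqI \<Gamma> t)
    then show ?thesis by simp
  next
    case (EqE \<Gamma> s t x \<phi>)
    then show ?thesis using v[OF EqE(2) e] v[OF EqE(3) e] \<Gamma> by (auto simp: sat_subst)
  qed
  then show ?thesis unfolding valid_in_def by blast
qed

lemma fm_length_le_proof_length:
  assumes "s \<in> set \<pi>"
  shows "fm_length (snd s) \<le> proof_length \<pi>"
proof -
  have "fm_length (snd s) \<le> length (sequent_str s @ '';'')"
    unfolding fm_length_def sequent_str_def by simp
  also have "\<dots> \<le> proof_length \<pi>"
    using assms member_le_sum_list[of "length (sequent_str s @ '';'')" "map (\<lambda>s. length (sequent_str s @ '';'')) \<pi>"]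
    unfolding proof_length_def by (force simp: length_concat o_def)
  finally show ?thesis .
qed

text \<open>Every axiom used is written out in the proof and so is no longer than it; longer axioms
  may fail in \<open>K\<close>.\<close>

lemma is_proof_sound:
  assumes pr: "is_proof T \<pi> \<phi>"
    and closed: "\<And>e t. range e \<subseteq> K \<Longrightarrow> tval e t \<in> K"
    and ax: "\<And>\<psi>. \<psi> \<in> T \<Longrightarrow> fm_length \<psi> \<le> proof_length \<pi> \<Longrightarrow> true_in K \<psi>"
  shows "true_in K \<phi>"
proof -
  have "valid_in K (\<pi> ! i)" if "i < length \<pi>" for i
    using that
  proof (induction i rule: less_induct)
    case (less i)
    have "infer T (set (take i \<pi>)) (\<pi> ! i)" using pr less.prems unfolding is_proof_def by blast
    then show ?case
    proof (rule infer_sound[OF _ closed])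
      fix s assume "s \<in> set (take i \<pi>)"
      then show "valid_in K s" using less by (auto simp: in_set_conv_nth)
    next
      assume "snd (\<pi> ! i) \<in> T"
      then show "true_in K (snd (\<pi> ! i))"
        by (rule ax) (use less.prems in \<open>simp add: fm_length_le_proof_length\<close>)
    qed
  qed
  then have "valid_in K ([], \<phi>)" using pr unfolding is_proof_def
    by (metis diff_less last_conv_nth length_greater_0_conv zero_less_one)
  then show ?thesis unfolding valid_in_def true_in_def by simp
qed

lemma sat_Alls:
  "range e \<subseteq> K \<Longrightarrow> sat K e (Alls xs \<phi>) \<Longrightarrow> sat K e \<phi>"
proof (induction xs)
  case (Cons x xs)
  then have "sat K (e(x := e x)) (Alls xs \<phi>)" by (auto simp del: fun_upd_triv)
  then show ?case using Cons by simp
qed simp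

lemma true_in_Alls: "true_in K \<phi> \<Longrightarrow> true_in K (Alls xs \<phi>)"
proof (induction xs)
  case (Cons x xs)
  then have *: "sat K e (Alls xs \<phi>)" if "range e \<subseteq> K" for e
    using that unfolding true_in_def by blast
  show ?case
    using *[OF range_fun_upd_subset] by (simp add: true_in_def del: fun_upd_apply)
qed simp

lemma true_in_closureD: "true_in K (closure \<phi>) \<Longrightarrow> range e \<subseteq> K \<Longrightarrow> sat K e \<phi>"
  unfolding closure_def true_in_def using sat_Alls by blast

section \<open>Models of finite fragments of RCF\<close>

lemma tval_tpow: "0 < n \<Longrightarrow> tval e (tpow t n) = tval e t ^ n"
  by (induction n) (auto simp: mult.commute)

lemma tval_low_poly: "tval e (low_poly t n) = (\<Sum>i\<le>n. e i * tval e t ^ i)"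
  by (induction n) (simp_all add: tval_tpow add.commute del: tpow.simps)

text \<open>The bound \<open>2 < N\<close> covers quadratic polynomials, so that square roots exist
  in \<open>K\<close> and the defined order is the real one.\<close>

locale roots_closed_subfield = subfield_set K for K :: "real set" +
  fixes N :: nat
  assumes N: "2 < N"
    and root_mem: "poly_over f \<Longrightarrow> f \<noteq> 0 \<Longrightarrow> degree f < N \<Longrightarrow> poly f \<beta> = 0 \<Longrightarrow> \<beta> \<in> K"
begin

lemma tval_mem: "range e \<subseteq> K \<Longrightarrow> tval e t \<in> K"
  by (induction t) (auto intro: zero_mem one_mem add_mem mult_mem)

lemma sqrt_mem:
  assumes "x \<in> K" "0 \<le> x"
  shows "sqrt x \<in> K"
proof (rule root_mem)
  show "poly_over [:- x, 0, 1:]"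
    using assms(1) by (auto simp: poly_over_def coeff_pCons zero_mem one_mem uminus_mem split: nat.split)
  show "poly [:- x, 0, 1:] (sqrt x) = 0" using assms(2) by simp
qed (use N in auto)

text \<open>Squares are nonnegative; conversely the square root of the difference is a witness in
  \<open>K\<close>.\<close>

lemma sat_Le:
  assumes "range e \<subseteq> K" "z \<notin> tvars s" "z \<notin> tvars t"
  shows "sat K e (Le z s t) \<longleftrightarrow> tval e s \<le> tval e t"
proof
  assume "sat K e (Le z s t)"
  then obtain d where "tval e s + d * d = tval e t"
    using assms by (auto simp: Le_def tval_fun_upd_fresh)
  then show "tval e s \<le> tval e t" using zero_le_square[of d] by linarith
next
  assume le: "tval e s \<le> tval e t"
  then have "sqrt (tval e t - tval e s) \<in> K"
    by (intro sqrt_mem diff_mem tval_mem assms(1)) simp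
  then show "sat K e (Le z s t)"
    using le assms(2,3) by (auto simp: Le_def tval_fun_upd_fresh intro!: bexI)
qed

lemma true_in_field_axioms:
  assumes "\<phi> \<in> field_axioms"
  shows "true_in K \<phi>"
proof -
  have "\<exists>y\<in>K. x + y = 0" if "x \<in> K" for x
    using uminus_mem[OF that] by (intro bexI[of _ "- x"]) auto
  moreover have "\<exists>y\<in>K. x * y = 1" if "x \<in> K" "x \<noteq> 0" for x
    using divide_mem[OF one_mem that(1)] that(2) by (intro bexI[of _ "1 / x"]) auto
  ultimately show ?thesis
    using assms unfolding field_axioms_def Let_def
    by (elim insertE emptyE; clarify; simp add: true_in_def ac_simps distrib_left)
qed

lemma true_in_order_axioms:
  assumes "\<phi> \<in> order_axioms"
  shows "true_in K \<phi>"
  using assms unfolding order_axioms_def Let_def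
  by (elim insertE emptyE; clarify; intro true_in_Alls)
    (auto simp: true_in_def sat_Le)

lemma true_in_sqrt_axiom: "true_in K sqrt_axiom"
proof -
  have "\<exists>d\<in>K. d * d = x" if "x \<in> K" "0 \<le> x" for x
    using sqrt_mem[OF that] that(2) by (intro bexI[of _ "sqrt x"]) auto
  then have "true_in K (Alls [0] (Imp (Le 2 Zer (Var 0)) (Ex 1 (Eq (Mul (Var 1) (Var 1)) (Var 0)))))"
    by (intro true_in_Alls) (auto simp: true_in_def sat_Le range_subsetD)
  then show ?thesis by (simp add: sqrt_axiom_def)
qed

text \<open>A real root exists because the degree is odd, and it lies in \<open>K\<close> because
  the degree is below \<open>N\<close>.\<close>

lemma true_in_root_axiom:
  assumes "odd n" "n < N"
  shows "true_in K (root_axiom n)"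
  unfolding root_axiom_def
proof (rule true_in_Alls, unfold true_in_def, intro allI impI)
  fix e :: "nat \<Rightarrow> real" assume e: "range e \<subseteq> K"
  obtain m where n: "n = Suc m" using assms(1) by (cases n) auto
  define f where "f = monom 1 n + (\<Sum>i\<le>m. monom (e i) i)"
  have coeff_f: "coeff f i = (if i = n then 1 else if i \<le> m then e i else 0)" for i
    unfolding f_def by (simp add: coeff_sum n)
  have deg: "degree f = n"
    by (rule antisym) (auto intro!: degree_le le_degree simp: coeff_f n)
  obtain \<beta> where \<beta>: "poly f \<beta> = 0" using real_poly_odd_degree_root[of f] assms(1) deg by blast
  have "\<beta> \<in> K"
  proof (rule root_mem[OF _ _ _ \<beta>])
    show "poly_over f" using e unfolding poly_over_def coeff_f by (auto simp: one_mem zero_mem)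
    show "f \<noteq> 0" using deg n by auto
  qed (use deg assms in simp)
  moreover have "sat K (e(n := \<beta>)) (Eq (Add (tpow (Var n) n) (low_poly (Var n) (n - 1))) Zer)"
    using \<beta> unfolding f_def
    by (simp add: tval_tpow tval_low_poly poly_sum poly_monom n del: tpow.simps)
  ultimately show "sat K e (Ex n (Eq (Add (tpow (Var n) n) (low_poly (Var n) (n - 1))) Zer))"
    by auto
qed

end

lemma fm_length_simps [simp]:
  "fm_length (Eq s t) = length (trm_str s) + length (trm_str t) + 3"
  "fm_length Bot = 1"
  "fm_length (Imp \<phi> \<psi>) = fm_length \<phi> + fm_length \<psi> + 3"
  "fm_length (And \<phi> \<psi>) = fm_length \<phi> + fm_length \<psi> + 3"
  "fm_length (Or \<phi> \<psi>) = fm_length \<phi> + fm_length \<psi> + 3"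
  "fm_length (All x \<phi>) = length (trm_str (Var x)) + fm_length \<phi> + 1"
  "fm_length (Ex x \<phi>) = length (trm_str (Var x)) + fm_length \<phi> + 1"
  by (simp_all add: fm_length_def)

text \<open>Bounds the degree of a root axiom by its length, as \<open>root_axiom n\<close> begins
  with \<open>n\<close> universal quantifiers.\<close>

lemma length_le_fm_length_Alls: "length xs \<le> fm_length (Alls xs \<phi>)"
  by (induction xs) auto

context roots_closed_subfield
begin

lemma true_in_RCF:
  assumes "\<phi> \<in> RCF" "fm_length \<phi> < N"
  shows "true_in K \<phi>"
  using assms(1) unfolding RCF_def RCF_minus_def
proof (elim UnE)
  assume "\<phi> \<in> {root_axiom n | n. odd n}"
  then obtain n where n: "odd n" "\<phi> = root_axiom n" by blast
  then have "n \<le> fm_length \<phi>"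
    using length_le_fm_length_Alls[of "[0..<n]"] unfolding root_axiom_def by simp
  then show ?thesis using n true_in_root_axiom assms(2) by simp
qed (auto intro: true_in_field_axioms true_in_order_axioms true_in_sqrt_axiom)

end

section \<open>Defining large powers by short formulas\<close>

text \<open>
  \<open>power_graph k\<close> holds of \<open>(x\<^sub>0, x\<^sub>1, x\<^sub>2)\<close> only if \<open>x\<^sub>1\<close> is a natural number \<open>m\<close> with \<open>x\<^sub>2 = x\<^sub>0\<^sup>m\<close>,
  and it holds for all such triples with \<open>m \<le> 2\<^bsup>2\<^bsup>k\<^esup>\<^esup>\<close>.  The step writes \<open>m = ab + c\<close> and
  \<open>x\<^sup>m = (x\<^sup>a)\<^sup>b x\<^sup>c\<close>; the universal quantifiers merge the three recursive calls into one, which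
  keeps the length linear in \<open>k\<close>.
\<close>

abbreviation triple_eq :: "nat \<Rightarrow> nat \<Rightarrow> nat \<Rightarrow> fm" where
  "triple_eq i j l \<equiv> And (Eq (Var 0) (Var i)) (And (Eq (Var 1) (Var j)) (Eq (Var 2) (Var l)))"

primrec power_graph :: "nat \<Rightarrow> fm" where
  "power_graph 0 =
     Or (And (Eq (Var 1) Zer) (Eq (Var 2) Unity))
       (Or (And (Eq (Var 1) Unity) (Eq (Var 2) (Var 0)))
         (And (Eq (Var 1) (Add Unity Unity)) (Eq (Var 2) (Mul (Var 0) (Var 0)))))"
| "power_graph (Suc k) =
     foldr Ex [3, 4, 5, 6, 7, 8, 9]
       (And (Eq (Var 9) (Var 0))
         (And (Eq (Var 1) (Add (Mul (Var 3) (Var 4)) (Var 5)))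
           (And (Eq (Var 2) (Mul (Var 7) (Var 8)))
             (Alls [0, 1, 2]
               (Imp (Or (triple_eq 9 3 6) (Or (triple_eq 6 4 7) (triple_eq 9 5 8)))
                 (power_graph k))))))"

lemma fv_power_graph: "fv (power_graph k) \<subseteq> {0, 1, 2}"
  by (induction k) auto

text \<open>Variables 0, 1, 2 hold base, exponent and value; the default 0 elsewhere is harmless,
  since no other variable is free.\<close>

definition in_power_graph :: "'a :: comm_semiring_1 set \<Rightarrow> nat \<Rightarrow> 'a \<Rightarrow> 'a \<Rightarrow> 'a \<Rightarrow> bool" where
  "in_power_graph K k x n y \<longleftrightarrow> sat K ((\<lambda>_. 0)(0 := x, 1 := n, 2 := y)) (power_graph k)"

lemma sat_power_graph: "sat K e (power_graph k) \<longleftrightarrow> in_power_graph K k (e 0) (e 1) (e 2)"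
  unfolding in_power_graph_def by (rule sat_cong) (use fv_power_graph[of k] in auto)

text \<open>Unfolds the merged call into three. Variable 9, here \<open>x'\<close>, keeps a copy of
  the base because the inner quantifiers rebind variable 0.\<close>

lemma in_power_graph_Suc:
  assumes "x \<in> K" "n \<in> K" "y \<in> K"
  shows "in_power_graph K (Suc k) x n y \<longleftrightarrow>
    (\<exists>a\<in>K. \<exists>b\<in>K. \<exists>c\<in>K. \<exists>z\<in>K. \<exists>w\<in>K. \<exists>v\<in>K. n = a * b + c \<and> y = w * v \<and>
      in_power_graph K k x a z \<and> in_power_graph K k z b w \<and> in_power_graph K k x c v)"
proof -
  have "in_power_graph K (Suc k) x n y \<longleftrightarrow>
    (\<exists>a\<in>K. \<exists>b\<in>K. \<exists>c\<in>K. \<exists>z\<in>K. \<exists>w\<in>K. \<exists>v\<in>K. \<exists>x'\<in>K. x' = x \<and> n = a * b + c \<and> y = w * v \<and>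
      (\<forall>X\<in>K. \<forall>M\<in>K. \<forall>Y\<in>K. X = x' \<and> M = a \<and> Y = z \<or> X = z \<and> M = b \<and> Y = w \<or>
        X = x' \<and> M = c \<and> Y = v \<longrightarrow> in_power_graph K k X M Y))"
    by (subst in_power_graph_def) (simp add: sat_power_graph)
  also have "\<dots> \<longleftrightarrow> (\<exists>a\<in>K. \<exists>b\<in>K. \<exists>c\<in>K. \<exists>z\<in>K. \<exists>w\<in>K. \<exists>v\<in>K. n = a * b + c \<and> y = w * v \<and>
      in_power_graph K k x a z \<and> in_power_graph K k z b w \<and> in_power_graph K k x c v)"
    using assms(1) by (intro bex_cong refl) auto
  finally show ?thesis .
qed

lemma in_power_graphD:
  assumes "in_power_graph K k x n y" "x \<in> K" "n \<in> K" "y \<in> K"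
  shows "\<exists>m. n = of_nat m \<and> y = x ^ m"
  using assms
proof (induction k arbitrary: x n y)
  case 0
  from 0(1) have "n = 0 \<and> y = 1 \<or> n = 1 \<and> y = x \<or> n = 1 + 1 \<and> y = x * x"
    by (simp add: in_power_graph_def)
  then have "n = of_nat 0 \<and> y = x ^ 0 \<or> n = of_nat 1 \<and> y = x ^ 1 \<or> n = of_nat 2 \<and> y = x ^ 2"
    by (simp add: power2_eq_square)
  then show ?case by blast
next
  case (Suc k)
  obtain a b c z w v where mem: "a \<in> K" "b \<in> K" "c \<in> K" "z \<in> K" "w \<in> K" "v \<in> K"
    and ny: "n = a * b + c" "y = w * v"
    and g: "in_power_graph K k x a z" "in_power_graph K k z b w" "in_power_graph K k x c v"
    using Suc.prems(1)[unfolded in_power_graph_Suc[OF Suc.prems(2-4)]] by blast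
  obtain i where i: "a = of_nat i" "z = x ^ i" using Suc.IH[OF g(1)] mem Suc.prems by blast
  obtain j where j: "b = of_nat j" "w = z ^ j" using Suc.IH[OF g(2)] mem by blast
  obtain l where l: "c = of_nat l" "v = x ^ l" using Suc.IH[OF g(3)] mem Suc.prems by blast
  have "n = of_nat (i * j + l) \<and> y = x ^ (i * j + l)"
    unfolding ny i j l by (simp add: power_add power_mult)
  then show ?case by blast
qed

text \<open>Division with remainder by \<open>B = 2^2^k\<close> splits \<open>m \<le> B * B\<close>
  into a quotient and a remainder that are both at most \<open>B\<close>.\<close>

lemma (in subfield_set) in_power_graphI:
  assumes "x \<in> K" "m \<le> 2 ^ 2 ^ k"
  shows "in_power_graph K k x (of_nat m) (x ^ m)"
  using assms
proof (induction k arbitrary: x m)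
  case 0
  then have "m = 0 \<or> m = 1 \<or> m = 2" by auto
  then show ?case by (auto simp: in_power_graph_def power2_eq_square)
next
  case (Suc k)
  define B :: nat where "B = 2 ^ 2 ^ k"
  have "B > 0" unfolding B_def by simp
  have "m \<le> B * B" using Suc.prems(2) unfolding B_def by (simp add: mult_2 power_add)
  then have "m div B \<le> B" using div_le_mono[of m "B * B" B] \<open>B > 0\<close> by simp
  then have *: "in_power_graph K k x (of_nat B) (x ^ B)"
      "in_power_graph K k (x ^ B) (of_nat (m div B)) ((x ^ B) ^ (m div B))"
      "in_power_graph K k x (of_nat (m mod B)) (x ^ (m mod B))"
    using Suc.prems(1) less_imp_le[OF mod_less_divisor[OF \<open>B > 0\<close>], of m]
    by (auto intro!: Suc.IH[folded B_def] power_mem)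
  have "m = B * (m div B) + m mod B" by simp
  then have "of_nat m = (of_nat B * of_nat (m div B) + of_nat (m mod B) :: 'a)"
    "x ^ m = (x ^ B) ^ (m div B) * x ^ (m mod B)"
    by (metis of_nat_add of_nat_mult, metis power_add power_mult)
  then show ?case
    unfolding in_power_graph_Suc[OF Suc.prems(1) of_nat_mem power_mem[OF Suc.prems(1)]]
    using * Suc.prems(1) of_nat_mem power_mem by meson
qed

section \<open>The least upper bound sentences and their length\<close>

definition power_le_two :: "nat \<Rightarrow> fm" where
  "power_le_two k = Ex 2 (And (power_graph k) (Le 3 (Var 2) (Add Unity Unity)))"

definition power_lub :: "nat \<Rightarrow> fm" where
  "power_lub k = closure (lub 0 4 5 3 (power_le_two k))"

lemma fv_power_le_two: "fv (power_le_two k) \<subseteq> {0, 1}"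
  using fv_power_graph[of k] by (auto simp: power_le_two_def Le_def)

lemma fv_lub_power_le_two: "fv (lub 0 4 5 3 (power_le_two k)) \<subseteq> {1}"
  using fv_power_le_two[of k] by (auto simp: lub_def Le_def)

text \<open>For the length estimate it suffices that the closure adds at most one quantifier, so it
  is left open which case occurs.\<close>

lemma power_lub_cases:
  "power_lub k = lub 0 4 5 3 (power_le_two k) \<or> power_lub k = All 1 (lub 0 4 5 3 (power_le_two k))"
proof -
  have "fv (lub 0 4 5 3 (power_le_two k)) = {} \<or> fv (lub 0 4 5 3 (power_le_two k)) = {1}"
    using fv_lub_power_le_two[of k] by (simp only: subset_singleton_iff)
  then show ?thesis unfolding power_lub_def closure_def by (elim disjE) simp_all
qed

lemma sentence_power_lub: "sentence (power_lub k)"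
proof -
  have "fv (Alls xs \<phi>) = fv \<phi> - set xs" for xs \<phi> by (induction xs) auto
  moreover have "finite (fv (lub 0 4 5 3 (power_le_two k)))"
    using fv_lub_power_le_two by (rule finite_subset) simp
  ultimately show ?thesis by (simp add: sentence_def power_lub_def closure_def)
qed

lemma power_lub_in_Tarski: "power_lub k \<in> Tarski"
proof -
  have "distinct [0::nat, 4, 5, 3]" "4 \<notin> fv (power_le_two k)" "5 \<notin> fv (power_le_two k)"
    using fv_power_le_two[of k] by auto
  then show ?thesis unfolding Tarski_def power_lub_def by blast
qed

lemma fm_length_power_lub: "fm_length (power_lub k) \<le> 1600 * k + 2000"
proof -
  note bin_str.simps[simp]
  have "fm_length (power_graph k) \<le> 400 * k + 200"
    by (induction k) simp_all
  then have "fm_length (power_le_two k) \<le> 400 * k + 300"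
    by (simp add: power_le_two_def Le_def)
  \<comment> \<open>The formula occurs four times in \<open>lub\<close>, which turns 400 into
    1600.\<close>
  then have "fm_length (lub 0 4 5 3 (power_le_two k)) \<le> 1600 * k + 1900"
    by (simp add: lub_def Le_def)
  then show ?thesis using power_lub_cases[of k] by auto
qed

section \<open>Failure of the sentences in the constructed field\<close>

lemma sup_below_irrational:
  fixes K :: "real set"
  assumes "subfield_set K" "\<alpha> \<notin> K" "c \<in> K"
  shows "\<not> ((\<forall>d\<in>K. d \<le> \<alpha> \<longrightarrow> d \<le> c) \<and> (\<forall>b\<in>K. (\<forall>d\<in>K. d \<le> \<alpha> \<longrightarrow> d \<le> b) \<longrightarrow> c \<le> b))"
proof
  interpret subfield_set K by fact
  assume *: "(\<forall>d\<in>K. d \<le> \<alpha> \<longrightarrow> d \<le> c) \<and> (\<forall>b\<in>K. (\<forall>d\<in>K. d \<le> \<alpha> \<longrightarrow> d \<le> b) \<longrightarrow> c \<le> b)"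
  have "c \<noteq> \<alpha>" using assms by blast
  moreover have dense: "\<exists>q\<in>K. a < q \<and> q < b" if ab: "a < b" for a b
  proof -
    obtain q where q: "q \<in> \<rat>" "a < q" "q < b" using Rats_dense_in_real[OF ab] by blast
    then obtain m n where "q = of_int m / of_int n" by (auto elim: Rats_cases')
    then show ?thesis using q divide_mem[OF of_int_mem of_int_mem] by blast
  qed
  \<comment> \<open>A rational between \<open>c\<close> and \<alpha> either exceeds \<open>c\<close>
    within the set or is an upper bound smaller than \<open>c\<close>.\<close>
  ultimately consider "c < \<alpha>" | "\<alpha> < c" by linarith
  then show False
  proof cases
    case 1
    then obtain q where "q \<in> K" "c < q" "q < \<alpha>" using dense by blast
    then show False using * by force
  next
    case 2
    then obtain q where "q \<in> K" "\<alpha> < q" "q < c" using dense by blast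
    then show False using * by force
  qed
qed

context roots_closed_subfield
begin

lemma sat_power_le_two:
  assumes e: "range e \<subseteq> K" "e 1 = of_nat p" and p: "p \<le> 2 ^ 2 ^ k"
  shows "sat K e (power_le_two k) \<longleftrightarrow> e 0 ^ p \<le> 2"
proof -
  have mem: "e i \<in> K" for i using e(1) by auto
  \<comment> \<open>The bound on \<open>p\<close> gives the direction from right to left; the other
    holds for all exponents.\<close>
  have graph: "in_power_graph K k (e 0) (of_nat p) y \<longleftrightarrow> y = e 0 ^ p" if "y \<in> K" for y
    using in_power_graphI[OF mem p] in_power_graphD[OF _ mem of_nat_mem that] by auto
  have "sat K (e(2 := y)) (And (power_graph k) (Le 3 (Var 2) (Add Unity Unity)))
      \<longleftrightarrow> in_power_graph K k (e 0) (of_nat p) y \<and> y \<le> 2" if "y \<in> K" for y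
    by (simp add: sat_power_graph sat_Le[OF range_fun_upd_subset[OF e(1) that]] e(2)
        del: One_nat_def)
  then have "sat K e (power_le_two k) \<longleftrightarrow> (\<exists>y\<in>K. in_power_graph K k (e 0) (of_nat p) y \<and> y \<le> 2)"
    unfolding power_le_two_def by simp
  also have "\<dots> \<longleftrightarrow> e 0 ^ p \<le> 2"
    using graph power_mem[OF mem] by blast
  finally show ?thesis .
qed

lemma not_true_in_power_lub:
  assumes p: "odd p" "p \<le> 2 ^ 2 ^ k" and \<alpha>: "0 < \<alpha>" "\<alpha> ^ p = 2" "\<alpha> \<notin> K"
  shows "\<not> true_in K (power_lub k)"
proof
  assume true: "true_in K (power_lub k)"
  define e :: "nat \<Rightarrow> real" where "e = (\<lambda>_. 0)(1 := of_nat p)"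
  have e: "range e \<subseteq> K" unfolding e_def using zero_mem of_nat_mem by auto
  have e1: "e 1 = of_nat p" unfolding e_def by simp
  \<comment> \<open>As \<open>p\<close> is odd, the power map is increasing on all reals, so
    negative \<open>d\<close> make no exception.\<close>
  have le: "d ^ p \<le> 2 \<longleftrightarrow> d \<le> \<alpha>" for d
  proof
    assume "d ^ p \<le> 2"
    then show "d \<le> \<alpha>" using \<alpha>(1,2) power_strict_mono[of \<alpha> d p] p(1)
      by (metis less_imp_le not_le odd_pos)
  next
    assume "d \<le> \<alpha>"
    then show "d ^ p \<le> 2" using power_mono_odd[OF p(1)] \<alpha>(2) by fastforce
  qed
  have phi: "sat K e' (power_le_two k) \<longleftrightarrow> e' 0 \<le> \<alpha>" if "range e' \<subseteq> K" "e' 1 = of_nat p" for e'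
    using sat_power_le_two[OF that p(2)] le by simp
  define U where "U = (\<lambda>v. All 0 (Imp (power_le_two k) (Le 3 (Var 0) (Var v))))"
  have upper: "sat K e' (U v) \<longleftrightarrow> (\<forall>d\<in>K. d \<le> \<alpha> \<longrightarrow> d \<le> e' v)"
    if e': "range e' \<subseteq> K" "e' 1 = of_nat p" and v: "v = 4 \<or> v = 5" for e' v
  proof -
    have "sat K (e'(0 := d)) (Imp (power_le_two k) (Le 3 (Var 0) (Var v)))
        \<longleftrightarrow> (d \<le> \<alpha> \<longrightarrow> d \<le> e' v)" if "d \<in> K" for d
      using range_fun_upd_subset[OF e'(1) that, of 0] e'(2) v by (auto simp: phi sat_Le)
    then show ?thesis unfolding U_def by simp
  qed
  have "sat K e (lub 0 4 5 3 (power_le_two k))"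
    using true_in_closureD[OF true[unfolded power_lub_def] e] .
  then have lub: "sat K e (Ex 0 (power_le_two k)) \<Longrightarrow> sat K e (Ex 4 (U 4)) \<Longrightarrow>
      sat K e (Ex 5 (And (U 5) (All 4 (Imp (U 4) (Le 3 (Var 5) (Var 4))))))"
    unfolding lub_def Let_def U_def sat.simps(3,4) by blast
  have "sat K (e(0 := 0)) (power_le_two k)"
    using phi[OF range_fun_upd_subset[OF e zero_mem]] e1 \<alpha>(1) by simp
  then have "sat K e (Ex 0 (power_le_two k))" using zero_mem by auto
  moreover have "sat K e (Ex 4 (U 4))"
  proof -
    \<comment> \<open>The bound must lie in \<open>K\<close>, which excludes \<alpha> itself; a
      natural number serves.\<close>
    obtain n where n: "\<alpha> \<le> of_nat n" using real_arch_simple by blast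
    have "sat K (e(4 := of_nat n)) (U 4)"
      using n e1 by (subst upper[OF range_fun_upd_subset[OF e of_nat_mem]]) auto
    then show ?thesis using of_nat_mem by auto
  qed
  ultimately obtain c where c: "c \<in> K" "sat K (e(5 := c)) (U 5)"
      "\<And>b. b \<in> K \<Longrightarrow> sat K (e(5 := c, 4 := b)) (U 4) \<Longrightarrow> sat K (e(5 := c, 4 := b)) (Le 3 (Var 5) (Var 4))"
    using lub by auto
  note ec = range_fun_upd_subset[OF e c(1), of 5]
  have "\<forall>d\<in>K. d \<le> \<alpha> \<longrightarrow> d \<le> c"
    using c(2) upper[OF ec, of 5] e1 by simp
  moreover have "c \<le> b" if b: "b \<in> K" "\<forall>d\<in>K. d \<le> \<alpha> \<longrightarrow> d \<le> b" for b
    using c(3)[OF b(1)] upper[OF range_fun_upd_subset[OF ec b(1), of 4], of 4]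
      sat_Le[OF range_fun_upd_subset[OF ec b(1), of 4], of 3 "Var 5" "Var 4"] b(2) e1 by simp
  ultimately show False using sup_below_irrational[OF subfield_set_axioms \<alpha>(3) c(1)] by blast
qed

end

section \<open>Lower bound on proof length\<close>

lemma RCF_proof_of_power_lub_long:
  assumes "is_proof RCF \<pi> (power_lub k)" and p: "prime p" "2 < p" "p \<le> 2 ^ 2 ^ k"
  shows "p \<le> proof_length \<pi>"
proof (rule ccontr)
  assume short: "\<not> p \<le> proof_length \<pi>"
  define \<alpha> where "\<alpha> = root p 2"
  have \<alpha>: "0 < \<alpha>" "\<alpha> ^ p = 2" unfolding \<alpha>_def using p(2) by simp_all
  obtain K :: "real set" where K: "subfield_set K" "\<alpha> \<notin> K"
    "\<And>f \<beta>. subfield_set.poly_over K f \<Longrightarrow> f \<noteq> 0 \<Longrightarrow> degree f < p \<Longrightarrow> poly f \<beta> = 0 \<Longrightarrow> \<beta> \<in> K"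
    using almost_real_closed_subfield[OF p(1) \<alpha>] by metis
  interpret roots_closed_subfield K p
    by (intro roots_closed_subfield.intro roots_closed_subfield_axioms.intro K p)
  have "true_in K (power_lub k)"
    using assms(1) tval_mem
  proof (rule is_proof_sound)
    \<comment> \<open>By \<open>short\<close> such an axiom has fewer than \<open>p\<close>
      characters, so a root axiom among them has degree below \<open>p\<close>.\<close>
    fix \<psi> assume "\<psi> \<in> RCF" "fm_length \<psi> \<le> proof_length \<pi>"
    then show "true_in K \<psi>" using true_in_RCF short by simp
  qed
  moreover have "odd p" using p prime_odd_nat by blast
  ultimately show False using not_true_in_power_lub p(3) \<alpha> K(2) by blast
qed

theorem theorem4:
  shows "\<exists>(\<epsilon>::real) (\<phi> :: nat \<Rightarrow> fm).
    \<epsilon> > 0 \<and>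
    (\<forall>i. sentence (\<phi> i)) \<and>
    (\<exists>p :: nat poly. \<forall>i. fm_length (\<phi> i) \<le> poly p i) \<and>
    (\<exists>q :: nat poly. \<forall>i. \<exists>\<pi>. is_proof Tarski \<pi> (\<phi> i) \<and> proof_length \<pi> \<le> poly q i) \<and>
    (\<forall>i \<pi>. is_proof RCF \<pi> (\<phi> i) \<longrightarrow>
       real (proof_length \<pi>) \<ge> 2 powr (2 powr (real i powr \<epsilon>)))"
proof (intro exI[of _ "1 :: real"] exI[of _ "\<lambda>i. power_lub (i + 3)"] conjI allI impI)
  \<comment> \<open>\<epsilon> is 1. The shift by 3 allows a prime between \<open>2^2^(i+2)\<close>
    and \<open>2^2^(i+3)\<close>, where \<open>2 \<le> i + 2\<close> as the prime lemma
    demands.\<close>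
  show "(0 :: real) < 1" by simp
  show "sentence (power_lub (i + 3))" for i by (rule sentence_power_lub)
  \<comment> \<open>The 2 counts the colon and the semicolon of the one-line proof.\<close>
  have len: "fm_length (power_lub (i + 3)) + 2 \<le> poly [:7000, 1600:] i" for i
    using fm_length_power_lub[of "i + 3"] by simp
  show "\<exists>p. \<forall>i. fm_length (power_lub (i + 3)) \<le> poly p i"
    using len add_leD1 by blast
  have "is_proof Tarski [([], power_lub k)] (power_lub k)" for k
    using power_lub_in_Tarski by (simp add: is_proof_def infer.Axiom)
  moreover have "proof_length [([], \<phi>)] = fm_length \<phi> + 2" for \<phi>
    by (simp add: proof_length_def sequent_str_def fm_length_def)
  ultimately show "\<exists>q. \<forall>i. \<exists>\<pi>. is_proof Tarski \<pi> (power_lub (i + 3)) \<and> proof_length \<pi> \<le> poly q i"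
    using len by metis
  fix i \<pi> assume \<pi>: "is_proof RCF \<pi> (power_lub (i + 3))"
  obtain p :: nat where p: "prime p" "2 ^ 2 ^ (i + 2) < p" "p \<le> 2 ^ 2 ^ (i + 3)"
    using prime_between_double_exponentials[of "i + 2"] by (auto simp: numeral_3_eq_3)
  have "(2 :: nat) ^ 1 \<le> 2 ^ 2 ^ (i + 2)" by (rule power_increasing) auto
  then have "2 < p" using p(2) unfolding power_one_right by (rule le_less_trans)
  then have "p \<le> proof_length \<pi>"
    using RCF_proof_of_power_lub_long[OF \<pi> p(1) _ p(3)] by blast
  moreover have "(2 :: nat) ^ 2 ^ i \<le> 2 ^ 2 ^ (i + 2)" by (intro power_increasing) auto
  ultimately have "2 ^ 2 ^ i \<le> proof_length \<pi>" using p(2) by linarith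
  then have "real (2 ^ 2 ^ i) \<le> real (proof_length \<pi>)" by (simp only: of_nat_le_iff)
  moreover have "2 powr (2 powr (real i powr 1)) = real (2 ^ 2 ^ i)"
    by (simp add: powr_realpow[symmetric])
  ultimately show "2 powr (2 powr (real i powr 1)) \<le> real (proof_length \<pi>)" by simp
qed

end
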